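(* The kernel $K:\mathbb{R}^2\setminus\{0\}\to\mathbb{R}$ of the operator $\mathcal{L}$ with Fourier symbol $\tilde m(k)=\frac{2\mu r_2(pk_1^2+k_3^2)}{r_1r_2-\nu k_1^2}$, i.e. the function $K$ for which $$\mathcal{L}w(x)=-\frac1{4\pi}\int_{\mathbb{R}^2}\big(w(x-y)+w(x+y)-2w(x)\big)K(y)\,dy,\qquad w\in\mathcal{S}(\mathbb{R}^2),$$ is given by $$K(x)=2\mu\delta\big(\sqrt\delta K_1(x)+\nu K_2(x)\big),$$ where $K_1$ and $K_2$ are the explicit functions defined in the context.
   Context: The real parameters $\mu,\delta,\nu$ satisfy $\mu>0$, $0<\delta<4$, $1-\frac2\delta<\nu<\frac12$. Variables: $x=(x_1,x_3)$, $k=(k_1,k_3)$; $r_1=\sqrt{k_1^2+k_3^2/\delta}$, $r_2=\sqrt{k_1^2+k_3^2}$; $\widehat{\mathcal{L}w}=\tilde m\,\hat w$ with $\hat w(k)=\int_{\mathbb{R}^2}e^{-\imath x\cdot k}w(x)\,dx$. Put $p=\delta(2(1-\nu)-\delta(1-2\nu))$, $b=1+\delta$, $c=\delta(1-\nu^2)$. $$K_1=\frac{A x_1^{12}+Bx_1^{10}x_3^2+Cx_1^8x_3^4+Dx_1^6x_3^6+Ex_1^4x_3^8+Fx_1^2x_3^{10}+Gx_3^{12}}{(x_1^2+\delta x_3^2)^{3/2}(x_1^4+bx_1^2x_3^2+cx_3^4)^3}$$ with $A=\frac{-2b+\delta+2p+2}{\delta}$, $B=\frac{3(2b^2-2b(\delta+p+1)-4c+3\delta+3\delta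 p+4p)}{\delta}$, $C=\frac{9b^2\delta+6c(3b-5\delta-4p-4)-6b(\delta^2+\delta+\delta p-p)+3\delta(2\delta+2\delta p+11p)}{\delta}$, $D=\frac{b^2(\delta(2\delta+1)+(\delta+2)p)-2b(c(-13\delta+p+1)+\delta(\delta+(\delta-13)p))}{\delta}+\frac{20c^2-2c(\delta(10\delta+23)+(23\delta+10)p)+20\delta^2p}{\delta}$, $E=\frac{-6c(b(-\delta^2+\delta+\delta p+p)+\delta(4\delta+4\delta p+5p))+9b\delta p(b+2\delta)+c^2(33\delta+6p+6)}{\delta}$, $F=6b^2\delta p-6c(b(\delta+\delta p+p)+2\delta p)+3c^2(4\delta+3p+3)$, $G=c(c(2\delta+2\delta p+p)-2b\delta p)$. $$K_2=\frac{A x_1^{12}+Bx_1^{10}x_3^2+Cx_1^8x_3^4+Dx_1^6x_3^6+Ex_1^4x_3^8+Fx_1^2x_3^{10}+Gx_3^{12}}{(x_1^2+x_3^2)^{3/2}(x_1^4+bx_1^2x_3^2+cx_3^4)^3}$$ with $A=2$, $B=-6b+12p+9$, $C=6b(p-1)-24c+33p+6$, $D=b^2-2b(c+1)+2(b+13)bp-20cp-46c+20p$, $E=-6c((b+5)p+b+4)+9b(b+2)p+6c^2$, $F=6b^2p-6bc(p+1)+3c(3c-4p)$, $G=c(c(p+2)-2bp)$. *)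

theory Defs
  imports "HOL-Analysis.Analysis"
begin

(* Points of the plane are pairs: (x1, x3) for positions, (k1, k3) for wave vectors. *)

(* D i j is the partial derivative of order i in the first and j in the second variable; D is
   determined by w.  Frechet differentiability at every level makes w infinitely differentiable,
   and the last condition is rapid decay of every derivative. *)
definition schwartz :: "(real \<times> real \<Rightarrow> complex) \<Rightarrow> bool" where
  "schwartz w \<longleftrightarrow>
    (\<exists>D :: nat \<Rightarrow> nat \<Rightarrow> real \<times> real \<Rightarrow> complex.
       D 0 0 = w \<and>
       (\<forall>i j x. (D i j has_derivative
                  (\<lambda>h. fst h *\<^sub>R D (Suc i) j x + snd h *\<^sub>R D i (Suc j) x)) (at x)) \<and>
       (\<forall>i j n. bounded (range (\<lambda>x. norm x ^ n *\<^sub>R D i j x))))"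

definition fourier :: "(real \<times> real \<Rightarrow> complex) \<Rightarrow> real \<times> real \<Rightarrow> complex" where
  "fourier w k = (LINT x|lborel. exp (- (\<i> * of_real (x \<bullet> k))) * w x)"

(* The inverse of the transform above, with its factor (2 pi)^(-2). *)
definition inverse_fourier :: "(real \<times> real \<Rightarrow> complex) \<Rightarrow> real \<times> real \<Rightarrow> complex" where
  "inverse_fourier v x = of_real (1 / (2 * pi)\<^sup>2) * (LINT k|lborel. exp (\<i> * of_real (x \<bullet> k)) * v k)"

(* For Schwartz w and a continuous symbol m of at most polynomial growth the integrand below is
   absolutely integrable, so this is the operator given on the Fourier side by multiplication
   with m. *)
definition symbol_operator ::
    "(real \<times> real \<Rightarrow> real) \<Rightarrow> (real \<times> real \<Rightarrow> complex) \<Rightarrow> real \<times> real \<Rightarrow> complex" where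
  "symbol_operator m w = inverse_fourier (\<lambda>k. of_real (m k) * fourier w k)"

(* The kernel lives on the plane without the origin; its value at the origin, a null set, plays no
   role.  Absolute convergence is required explicitly because a divergent Bochner integral has the
   value 0. *)
definition has_kernel ::
    "((real \<times> real \<Rightarrow> complex) \<Rightarrow> real \<times> real \<Rightarrow> complex) \<Rightarrow> (real \<times> real \<Rightarrow> real) \<Rightarrow> bool" where
  "has_kernel L K \<longleftrightarrow>
    (\<forall>w. schwartz w \<longrightarrow> (\<forall>x.
       integrable lborel (\<lambda>y. (w (x - y) + w (x + y) - 2 * w x) * of_real (K y)) \<and>
       L w x = - of_real (1 / (4 * pi)) *
         (LINT y|lborel. (w (x - y) + w (x + y) - 2 * w x) * of_real (K y))))"

definition par_p :: "real \<Rightarrow> real \<Rightarrow> real" where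
  "par_p \<delta> \<nu> = \<delta> * (2 * (1 - \<nu>) - \<delta> * (1 - 2 * \<nu>))"

definition par_b :: "real \<Rightarrow> real" where
  "par_b \<delta> = 1 + \<delta>"

definition par_c :: "real \<Rightarrow> real \<Rightarrow> real" where
  "par_c \<delta> \<nu> = \<delta> * (1 - \<nu>\<^sup>2)"

(* At k = 0 this is 0 / 0 = 0, the continuous extension. *)
definition symbol :: "real \<Rightarrow> real \<Rightarrow> real \<Rightarrow> real \<times> real \<Rightarrow> real" where
  "symbol \<mu> \<delta> \<nu> k =
    (let k1 = fst k; k3 = snd k; p = par_p \<delta> \<nu>;
         r1 = sqrt (k1\<^sup>2 + k3\<^sup>2 / \<delta>);
         r2 = sqrt (k1\<^sup>2 + k3\<^sup>2)
     in 2 * \<mu> * r2 * (p * k1\<^sup>2 + k3\<^sup>2) / (r1 * r2 - \<nu> * k1\<^sup>2))"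

definition quartic :: "real \<Rightarrow> real \<Rightarrow> real \<times> real \<Rightarrow> real" where
  "quartic \<delta> \<nu> x = fst x ^ 4 + par_b \<delta> * (fst x)\<^sup>2 * (snd x)\<^sup>2 + par_c \<delta> \<nu> * snd x ^ 4"

definition form12 ::
    "real \<Rightarrow> real \<Rightarrow> real \<Rightarrow> real \<Rightarrow> real \<Rightarrow> real \<Rightarrow> real \<Rightarrow> real \<times> real \<Rightarrow> real" where
  "form12 A B C D E F G x =
    (let x1 = fst x; x3 = snd x in
      A * x1 ^ 12 + B * x1 ^ 10 * x3 ^ 2 + C * x1 ^ 8 * x3 ^ 4 + D * x1 ^ 6 * x3 ^ 6
      + E * x1 ^ 4 * x3 ^ 8 + F * x1 ^ 2 * x3 ^ 10 + G * x3 ^ 12)"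

definition K1 :: "real \<Rightarrow> real \<Rightarrow> real \<times> real \<Rightarrow> real" where
  "K1 \<delta> \<nu> x =
    (let p = par_p \<delta> \<nu>; b = par_b \<delta>; c = par_c \<delta> \<nu>;
         A = (- 2 * b + \<delta> + 2 * p + 2) / \<delta>;
         B = 3 * (2 * b\<^sup>2 - 2 * b * (\<delta> + p + 1) - 4 * c + 3 * \<delta> + 3 * \<delta> * p + 4 * p) / \<delta>;
         C = (9 * b\<^sup>2 * \<delta> + 6 * c * (3 * b - 5 * \<delta> - 4 * p - 4)
              - 6 * b * (\<delta>\<^sup>2 + \<delta> + \<delta> * p - p) + 3 * \<delta> * (2 * \<delta> + 2 * \<delta> * p + 11 * p)) / \<delta>;
         D = (b\<^sup>2 * (\<delta> * (2 * \<delta> + 1) + (\<delta> + 2) * p)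
              - 2 * b * (c * (- 13 * \<delta> + p + 1) + \<delta> * (\<delta> + (\<delta> - 13) * p))) / \<delta>
             + (20 * c\<^sup>2 - 2 * c * (\<delta> * (10 * \<delta> + 23) + (23 * \<delta> + 10) * p)
                + 20 * \<delta>\<^sup>2 * p) / \<delta>;
         E = (- 6 * c * (b * (- \<delta>\<^sup>2 + \<delta> + \<delta> * p + p) + \<delta> * (4 * \<delta> + 4 * \<delta> * p + 5 * p))
              + 9 * b * \<delta> * p * (b + 2 * \<delta>) + c\<^sup>2 * (33 * \<delta> + 6 * p + 6)) / \<delta>;
         F = 6 * b\<^sup>2 * \<delta> * p - 6 * c * (b * (\<delta> + \<delta> * p + p) + 2 * \<delta> * p)
             + 3 * c\<^sup>2 * (4 * \<delta> + 3 * p + 3);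
         G = c * (c * (2 * \<delta> + 2 * \<delta> * p + p) - 2 * b * \<delta> * p)
     in form12 A B C D E F G x
        / (((fst x)\<^sup>2 + \<delta> * (snd x)\<^sup>2) powr (3 / 2) * quartic \<delta> \<nu> x ^ 3))"

definition K2 :: "real \<Rightarrow> real \<Rightarrow> real \<times> real \<Rightarrow> real" where
  "K2 \<delta> \<nu> x =
    (let p = par_p \<delta> \<nu>; b = par_b \<delta>; c = par_c \<delta> \<nu>;
         A = 2;
         B = - 6 * b + 12 * p + 9;
         C = 6 * b * (p - 1) - 24 * c + 33 * p + 6;
         D = b\<^sup>2 - 2 * b * (c + 1) + 2 * (b + 13) * b * p - 20 * c * p - 46 * c + 20 * p;
         E = - 6 * c * ((b + 5) * p + b + 4) + 9 * b * (b + 2) * p + 6 * c\<^sup>2;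
         F = 6 * b\<^sup>2 * p - 6 * b * c * (p + 1) + 3 * c * (3 * c - 4 * p);
         G = c * (c * (p + 2) - 2 * b * p)
     in form12 A B C D E F G x
        / (((fst x)\<^sup>2 + (snd x)\<^sup>2) powr (3 / 2) * quartic \<delta> \<nu> x ^ 3))"

(* If nu <= -1 (possible when delta < 1) then c <= 0 and the quartic vanishes on finitely many
   lines through the origin, where this expression is undefined (here: 0). *)
definition L_kernel :: "real \<Rightarrow> real \<Rightarrow> real \<Rightarrow> real \<times> real \<Rightarrow> real" where
  "L_kernel \<mu> \<delta> \<nu> x = 2 * \<mu> * \<delta> * (sqrt \<delta> * K1 \<delta> \<nu> x + \<nu> * K2 \<delta> \<nu> x)"

end

theory Submission
  imports Defs "HOL-Probability.Sinc_Integral" "HOL-Probability.Characteristic_Functions"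
    "HOL-Real_Asymp.Real_Asymp"
begin

text \<open>Testing the kernel identity on a plane wave, an even kernel \<open>K\<close> belongs to the symbol \<open>m\<close> exactly
when \<open>2 \<pi> m(k) = \<integral> (1 - cos (k \<bullet> y)) K(y) dy\<close>. The symbol is homogeneous of degree \<open>1\<close>, so \<open>K\<close> is
homogeneous of degree \<open>-3\<close>. In the coordinates \<open>y = (s, s t)\<close> the integral over \<open>s\<close> is the
classical \<open>\<integral> (1 - cos (a s)) / s\<^sup>2 ds = \<pi> \<bar>a\<bar>\<close>, and the condition becomes one-dimensional:
\<open>m(k) = 1/2 \<integral> \<bar>k\<^sub>1 + k\<^sub>3 t\<bar> K(1, t) dt\<close>. Since \<open>\<bar>t - a\<bar> / 2\<close> is a fundamental solution of the second
derivative, the solution is \<open>K(1, t) = g''(t)\<close> with \<open>g(t) = m(t, 1)\<close>: note the exchanged arguments,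
the kernel is the second derivative of the symbol on the rotated line. Both facts are in
\<open>symbol_eq_slope_integral\<close>; the boundary terms at infinity cancel because
\<open>g(t) = t m(1, 1 / t)\<close> for \<open>t > 0\<close>, with \<open>m(1, \<cdot>)\<close> even and twice continuously differentiable
(locale \<open>profile\<close>).

The explicit formula is the evaluation of \<open>g''\<close>. Expanding the symbol by
\<open>r\<^sub>1 r\<^sub>2 + \<nu> k\<^sub>1\<^sup>2\<close> turns its denominator into the quartic and splits \<open>g\<close> into two terms of the form
\<open>P sqrt (1 + e t\<^sup>2) / Q\<close> with polynomials \<open>P\<close> and \<open>Q\<close>. Differentiating them twice produces
numerators of degree \<open>12\<close>, which are those of \<open>K\<^sub>1\<close> and \<open>K\<^sub>2\<close> (\<open>form12_K1\<close>, \<open>form12_K2\<close>). Where the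
quartic vanishes the formula is meaningless, but these are finitely many slopes, hence a null set.

To pass from plane waves to Schwartz functions (\<open>has_kernel_of_symbol\<close>), \<open>w\<close> is written as the
inverse transform of its Fourier transform and the two integrals are exchanged. This rests on the
decay of the Fourier transform and on Fourier inversion, obtained by Gaussian regularization.

For uniqueness (\<open>has_kernel_unique_le\<close>), the difference \<open>d\<close> of two even kernels is tested at the
point \<open>0\<close> against \<open>q(y) exp (- n \<bar>y - z\<bar>\<^sup>2)\<close>, where the polynomial factor \<open>q\<close> vanishes at the
origin. As \<open>n\<close> grows these functions concentrate at \<open>z\<close>, which is impossible if \<open>d(z) > 0\<close>.\<close>

section \<open>Kernels homogeneous of degree minus three\<close>

text \<open>Integration by parts reduces the integral over the half line to the Dirichlet integral
\<open>\<integral> sin s / s ds = \<pi> / 2\<close>; the dependence on \<open>a\<close> is scaling. It is stated for the Lebesgue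
integral of a nonnegative function so that the theorem of Tonelli applies to it below.\<close>

lemma nn_integral_one_minus_cos:
  fixes a :: real
  shows "(\<integral>\<^sup>+s. ennreal ((1 - cos (a * s)) / s\<^sup>2) \<partial>lborel) = ennreal (pi * \<bar>a\<bar>)"
proof -
  define f where "f = (\<lambda>s::real. (1 - cos s) / s\<^sup>2)"
  have [measurable]: "f \<in> borel_measurable borel" unfolding f_def by measurable
  have f0: "f s \<ge> 0" for s by (simp add: f_def)
  \<comment> \<open>An antiderivative of \<open>f\<close> on the positive half line, from integration by parts.\<close>
  define F where "F = (\<lambda>s. Si s - (1 - cos s) / s)"
  have der: "(F has_real_derivative f s) (at s)" if "s > 0" for s
  proof -
    have "((\<lambda>s. (1 - cos s) / s) has_real_derivative (sin s * s - (1 - cos s)) / s\<^sup>2) (at s)"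
      using that by (auto intro!: derivative_eq_intros simp: power2_eq_square)
    from DERIV_diff[OF DERIV_Si this] that show ?thesis
      by (auto simp: F_def f_def field_simps power2_eq_square elim!: DERIV_cong)
  qed
  have lim0: "(F \<longlongrightarrow> 0) (at_right 0)"
  proof -
    have 1: "((\<lambda>s::real. (1 - cos s) / s) \<longlongrightarrow> 0) (at_right 0)" by real_asymp
    have "(Si \<longlongrightarrow> Si 0) (at_right 0)"
      using isCont_Si[of 0] by (auto simp: isCont_def intro: tendsto_mono[OF at_le])
    moreover have "Si 0 = 0" using Si_neg[of 0] by simp
    ultimately have "(Si \<longlongrightarrow> 0) (at_right 0)" by simp
    from tendsto_diff[OF this 1] show ?thesis unfolding F_def by simp
  qed
  have limT: "(F \<longlongrightarrow> pi / 2) at_top"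
  proof -
    have "((\<lambda>s::real. (1 - cos s) / s) \<longlongrightarrow> 0) at_top" by real_asymp
    from tendsto_diff[OF Si_at_top this] show ?thesis unfolding F_def by simp
  qed
  have I: "set_integrable lborel (einterval 0 \<infinity>) f" "(LBINT x=0..\<infinity>. f x) = pi / 2 - 0"
  proof -
    have "isCont f x" if "x > 0" for x
      unfolding f_def using that by (auto intro!: continuous_intros)
    moreover have "((F \<circ> real_of_ereal) \<longlongrightarrow> 0) (at_right 0)"
      using lim0 by (simp add: zero_ereal_def ereal_tendsto_simps)
    moreover have "((F \<circ> real_of_ereal) \<longlongrightarrow> pi / 2) (at_left \<infinity>)"
      using limT by (simp add: ereal_tendsto_simps)
    ultimately show "set_integrable lborel (einterval 0 \<infinity>) f" "(LBINT x=0..\<infinity>. f x) = pi / 2 - 0"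
      using interval_integral_FTC_nonneg[of 0 \<infinity> F f 0 "pi / 2"] der f0
      by (auto simp: zero_ereal_def)
  qed
  have half: "(\<integral>\<^sup>+s. ennreal (f s) * indicator {0<..} s \<partial>lborel) = ennreal (pi / 2)"
  proof -
    have e: "einterval 0 \<infinity> = {0<..}" by (auto simp: einterval_def zero_ereal_def)
    have "(\<integral>\<^sup>+s. ennreal (indicator {0<..} s *\<^sub>R f s) \<partial>lborel)
        = ennreal (\<integral>s. indicator {0<..} s *\<^sub>R f s \<partial>lborel)"
      using I(1) f0 unfolding set_integrable_def e
      by (intro nn_integral_eq_integral) (auto simp: indicator_def)
    also have "(\<integral>s. indicator {0<..} s *\<^sub>R f s \<partial>lborel) = pi / 2"
      using I(2) unfolding interval_lebesgue_integral_def set_lebesgue_integral_def e by simp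
    finally have "(\<integral>\<^sup>+s. ennreal (indicator {0<..} s *\<^sub>R f s) \<partial>lborel) = ennreal (pi / 2)" .
    then show ?thesis
      by (simp add: ennreal_mult' mult.commute f0 flip: ennreal_indicator)
  qed
  have "(\<integral>\<^sup>+s. ennreal (f s) \<partial>lborel)
      = (\<integral>\<^sup>+s. ennreal (f s) * indicator {0<..} s + ennreal (f s) * indicator {..<0} s \<partial>lborel)"
    using AE_lborel_singleton[of "0::real"]
    by (intro nn_integral_cong_AE) (auto simp: indicator_def)
  also have "\<dots> = ennreal (pi / 2) + (\<integral>\<^sup>+s. ennreal (f s) * indicator {..<0} s \<partial>lborel)"
    by (subst nn_integral_add) (auto simp: half)
  also have "(\<integral>\<^sup>+s. ennreal (f s) * indicator {..<0} s \<partial>lborel)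
      = (\<integral>\<^sup>+s. ennreal (f s) * indicator {0<..} s \<partial>lborel)"
    by (subst nn_integral_real_affine[where c="-1" and t=0])
       (auto simp: f_def indicator_def intro!: nn_integral_cong)
  also have "ennreal (pi / 2) + \<dots> = ennreal pi"
    by (simp add: half flip: ennreal_plus)
  finally have one: "(\<integral>\<^sup>+s. ennreal (f s) \<partial>lborel) = ennreal pi" .
  show ?thesis
  proof (cases "a = 0")
    case False
    have "ennreal pi = ennreal \<bar>a\<bar> * (\<integral>\<^sup>+s. ennreal (f (a * s)) \<partial>lborel)"
      using nn_integral_real_affine[of "\<lambda>s. ennreal (f s)" a 0] False one by simp
    also have "\<dots> = ennreal \<bar>a\<bar> * (\<integral>\<^sup>+s. ennreal (1 / a\<^sup>2) * ennreal ((1 - cos (a * s)) / s\<^sup>2) \<partial>lborel)"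
      by (auto simp: f_def power_mult_distrib simp flip: ennreal_mult' intro!: arg_cong2[where f="(*)"] nn_integral_cong)
    also have "\<dots> = ennreal (1 / \<bar>a\<bar>) * (\<integral>\<^sup>+s. ennreal ((1 - cos (a * s)) / s\<^sup>2) \<partial>lborel)"
      using False
      by (subst nn_integral_cmult) (auto simp: mult.assoc[symmetric] power2_eq_square abs_mult_self_eq field_simps
         simp flip: ennreal_mult' intro!: arg_cong2[where f="(*)"] arg_cong[where f=ennreal])
    finally have "ennreal \<bar>a\<bar> * ennreal pi = ennreal \<bar>a\<bar> * (ennreal (1 / \<bar>a\<bar>) * (\<integral>\<^sup>+s. ennreal ((1 - cos (a * s)) / s\<^sup>2) \<partial>lborel))"
      by simp
    also have "\<dots> = (\<integral>\<^sup>+s. ennreal ((1 - cos (a * s)) / s\<^sup>2) \<partial>lborel)"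
      using False by (simp add: mult.assoc[symmetric] flip: ennreal_mult')
    finally show ?thesis by (simp add: mult.commute flip: ennreal_mult')
  qed simp
qed

text \<open>These coordinates replace polar ones: \<open>s\<close> runs along the line of slope \<open>t\<close>, with Jacobian \<open>\<bar>s\<bar>\<close>.
They need only Tonelli and a linear substitution in the second variable, and they miss just the
vertical axis.\<close>

lemma nn_integral_plane_slopes:
  fixes f :: "real \<times> real \<Rightarrow> ennreal"
  assumes [measurable]: "f \<in> borel_measurable borel"
  shows "(\<integral>\<^sup>+y. f y \<partial>lborel) = (\<integral>\<^sup>+t. (\<integral>\<^sup>+s. ennreal \<bar>s\<bar> * f (s, s * t) \<partial>lborel) \<partial>lborel)"
proof -
  have [measurable]: "f \<in> borel_measurable (borel \<Otimes>\<^sub>M borel)" by (simp add: borel_prod)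
  have "(\<integral>\<^sup>+y. f y \<partial>lborel) = (\<integral>\<^sup>+s. (\<integral>\<^sup>+u. f (s, u) \<partial>lborel) \<partial>lborel)"
    unfolding lborel_prod[symmetric] by (rule lborel.nn_integral_fst[symmetric]) measurable
  also have "\<dots> = (\<integral>\<^sup>+s. (\<integral>\<^sup>+t. ennreal \<bar>s\<bar> * f (s, s * t) \<partial>lborel) \<partial>lborel)"
  proof (rule nn_integral_cong_AE)
    show "AE s in lborel. (\<integral>\<^sup>+u. f (s, u) \<partial>lborel) = (\<integral>\<^sup>+t. ennreal \<bar>s\<bar> * f (s, s * t) \<partial>lborel)"
      using AE_lborel_singleton[of "0::real"]
    proof eventually_elim
      case (elim s)
      then show ?case
        using nn_integral_real_affine[of "\<lambda>u. f (s, u)" s 0] by (simp add: nn_integral_cmult)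
    qed
  qed
  also have "\<dots> = (\<integral>\<^sup>+t. (\<integral>\<^sup>+s. ennreal \<bar>s\<bar> * f (s, s * t) \<partial>lborel) \<partial>lborel)"
    by (rule lborel_pair.Fubini') measurable
  finally show ?thesis .
qed

text \<open>Homogeneity of degree \<open>-3\<close> together with evenness, in the slope coordinates \<open>(s, s t)\<close>, which
cover the plane up to the vertical axis, a null set.\<close>

definition homogeneous_kernel :: "(real \<times> real \<Rightarrow> real) \<Rightarrow> bool" where
  "homogeneous_kernel K \<longleftrightarrow> K \<in> borel_measurable borel \<and>
     (\<forall>s t. s \<noteq> 0 \<longrightarrow> K (s, s * t) = K (1, t) / \<bar>s\<bar> ^ 3)"

text \<open>Since \<open>ennreal\<close> cuts off negative values, the formula describes the positive part of \<open>K\<close>. Applied to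
\<open>K\<close>, \<open>- K\<close> and \<open>\<bar>K\<bar>\<close> it gives integrability and the signed integral.\<close>

lemma nn_integral_homogeneous_kernel:
  fixes K :: "real \<times> real \<Rightarrow> real"
  assumes "homogeneous_kernel K"
  shows "(\<integral>\<^sup>+y. ennreal ((1 - cos (k \<bullet> y)) * K y) \<partial>lborel)
       = (\<integral>\<^sup>+t. ennreal (pi * (\<bar>fst k + snd k * t\<bar> * K (1, t))) \<partial>lborel)"
proof -
  have K[measurable]: "K \<in> borel_measurable borel"
    and hom: "\<And>s t. s \<noteq> 0 \<Longrightarrow> K (s, s * t) = K (1, t) / \<bar>s\<bar> ^ 3"
    using assms by (auto simp: homogeneous_kernel_def)
  have "(\<integral>\<^sup>+y. ennreal ((1 - cos (k \<bullet> y)) * K y) \<partial>lborel)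
    = (\<integral>\<^sup>+t. (\<integral>\<^sup>+s. ennreal \<bar>s\<bar> * ennreal ((1 - cos (k \<bullet> (s, s * t))) * K (s, s * t)) \<partial>lborel) \<partial>lborel)"
    by (rule nn_integral_plane_slopes) measurable
  also have "\<dots> = (\<integral>\<^sup>+t. (\<integral>\<^sup>+s. ennreal (K (1, t)) *
        ennreal ((1 - cos ((fst k + snd k * t) * s)) / s\<^sup>2) \<partial>lborel) \<partial>lborel)"
  proof (rule nn_integral_cong, rule nn_integral_cong_AE)
    fix t :: real
    show "AE s in lborel. ennreal \<bar>s\<bar> * ennreal ((1 - cos (k \<bullet> (s, s * t))) * K (s, s * t))
      = ennreal (K (1, t)) * ennreal ((1 - cos ((fst k + snd k * t) * s)) / s\<^sup>2)"
      using AE_lborel_singleton[of "0::real"]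
    proof eventually_elim
      case (elim s)
      have "\<bar>s\<bar> * ((1 - cos (k \<bullet> (s, s * t))) * K (s, s * t))
        = (1 - cos ((fst k + snd k * t) * s)) / s\<^sup>2 * K (1, t)"
        using elim by (cases k) (simp add: hom field_simps power2_eq_square power3_eq_cube)
      then show ?case
        by (simp add: mult.commute[of "ennreal (K _)"] flip: ennreal_mult')
    qed
  qed
  also have "\<dots> = (\<integral>\<^sup>+t. ennreal (K (1, t)) * ennreal (pi * \<bar>fst k + snd k * t\<bar>) \<partial>lborel)"
    by (intro nn_integral_cong) (subst nn_integral_cmult, auto simp: nn_integral_one_minus_cos)
  also have "\<dots> = (\<integral>\<^sup>+t. ennreal (pi * (\<bar>fst k + snd k * t\<bar> * K (1, t))) \<partial>lborel)"
    by (simp add: mult.commute[of "ennreal (K _)"] mult.assoc flip: ennreal_mult')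
  finally show ?thesis .
qed

text \<open>The weight \<open>1 + \<bar>t\<bar>\<close> dominates \<open>\<bar>k\<^sub>1 + k\<^sub>3 t\<bar>\<close> up to the factor \<open>norm k\<close>. That the bound is
linear in \<open>norm k\<close> is what makes the double integral in \<open>has_kernel_of_symbol\<close> converge.\<close>

lemma
  fixes K :: "real \<times> real \<Rightarrow> real"
  assumes K: "homogeneous_kernel K"
    and int: "integrable lborel (\<lambda>t. (1 + \<bar>t\<bar>) * K (1, t))"
  shows homogeneous_kernel_nn_bound:
      "(\<integral>\<^sup>+y. ennreal ((1 - cos (k \<bullet> y)) * \<bar>K y\<bar>) \<partial>lborel)
        \<le> ennreal (norm k * (pi * (\<integral>t. (1 + \<bar>t\<bar>) * \<bar>K (1, t)\<bar> \<partial>lborel)))"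
    and homogeneous_kernel_integrable: "integrable lborel (\<lambda>y. (1 - cos (k \<bullet> y)) * K y)"
    and homogeneous_kernel_integral: "(\<integral>y. (1 - cos (k \<bullet> y)) * K y \<partial>lborel)
      = pi * (\<integral>t. \<bar>fst k + snd k * t\<bar> * K (1, t) \<partial>lborel)"
proof -
  have Km[measurable]: "K \<in> borel_measurable borel"
    using K by (simp add: homogeneous_kernel_def)
  have K': "homogeneous_kernel (\<lambda>y. \<bar>K y\<bar>)" "homogeneous_kernel (\<lambda>y. - K y)"
    using K by (auto simp: homogeneous_kernel_def)
  have kt: "\<bar>fst k + snd k * t\<bar> \<le> norm k * (1 + \<bar>t\<bar>)" for t
  proof -
    have "\<bar>fst k + snd k * t\<bar> \<le> \<bar>fst k\<bar> + \<bar>snd k\<bar> * \<bar>t\<bar>"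
      by (metis abs_triangle_ineq abs_mult)
    also have "\<dots> \<le> norm k + norm k * \<bar>t\<bar>"
      using norm_fst_le[of "fst k" "snd k"] norm_snd_le[of "snd k" "fst k"]
      by (intro add_mono mult_right_mono) auto
    finally show ?thesis by (simp add: algebra_simps)
  qed
  have intabs: "integrable lborel (\<lambda>t. (1 + \<bar>t\<bar>) * \<bar>K (1, t)\<bar>)"
    using integrable_abs[OF int] by (simp add: abs_mult)
  show bound: "(\<integral>\<^sup>+y. ennreal ((1 - cos (k \<bullet> y)) * \<bar>K y\<bar>) \<partial>lborel)
        \<le> ennreal (norm k * (pi * (\<integral>t. (1 + \<bar>t\<bar>) * \<bar>K (1, t)\<bar> \<partial>lborel)))" (is "?l \<le> _")
  proof -
    have "?l = (\<integral>\<^sup>+t. ennreal (pi * (\<bar>fst k + snd k * t\<bar> * \<bar>K (1, t)\<bar>)) \<partial>lborel)"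
      by (rule nn_integral_homogeneous_kernel[OF K'(1)])
    also have "\<dots> \<le> (\<integral>\<^sup>+t. ennreal (norm k * pi * ((1 + \<bar>t\<bar>) * \<bar>K (1, t)\<bar>)) \<partial>lborel)"
    proof (intro nn_integral_mono ennreal_leI)
      fix t
      have "pi * (\<bar>fst k + snd k * t\<bar> * \<bar>K (1, t)\<bar>) \<le> pi * ((norm k * (1 + \<bar>t\<bar>)) * \<bar>K (1, t)\<bar>)"
        by (intro mult_left_mono mult_right_mono kt) auto
      then show "pi * (\<bar>fst k + snd k * t\<bar> * \<bar>K (1, t)\<bar>) \<le> norm k * pi * ((1 + \<bar>t\<bar>) * \<bar>K (1, t)\<bar>)"
        by (simp add: algebra_simps)
    qed
    also have "\<dots> = ennreal (\<integral>t. norm k * pi * ((1 + \<bar>t\<bar>) * \<bar>K (1, t)\<bar>) \<partial>lborel)"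
      using intabs by (intro nn_integral_eq_integral) auto
    finally show ?thesis by (simp add: mult.assoc)
  qed
  show 1: "integrable lborel (\<lambda>y. (1 - cos (k \<bullet> y)) * K y)"
    unfolding integrable_iff_bounded
  proof (intro conjI)
    have "(\<integral>\<^sup>+y. ennreal (norm ((1 - cos (k \<bullet> y)) * K y)) \<partial>lborel)
      = (\<integral>\<^sup>+y. ennreal ((1 - cos (k \<bullet> y)) * \<bar>K y\<bar>) \<partial>lborel)"
      by (simp add: abs_mult)
    also have "\<dots> < \<infinity>" using bound by (rule le_less_trans) simp
    finally show "(\<integral>\<^sup>+y. ennreal (norm ((1 - cos (k \<bullet> y)) * K y)) \<partial>lborel) < \<infinity>" .
  qed measurable
  have 2: "integrable lborel (\<lambda>t. pi * (\<bar>fst k + snd k * t\<bar> * K (1, t)))"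
  proof (rule Bochner_Integration.integrable_bound)
    show "integrable lborel (\<lambda>t. pi * (norm k * ((1 + \<bar>t\<bar>) * \<bar>K (1, t)\<bar>)))"
      using intabs by simp
    show "AE t in lborel. norm (pi * (\<bar>fst k + snd k * t\<bar> * K (1, t)))
        \<le> norm (pi * (norm k * ((1 + \<bar>t\<bar>) * \<bar>K (1, t)\<bar>)))"
    proof (rule AE_I2)
      fix t
      have "pi * (\<bar>fst k + snd k * t\<bar> * \<bar>K (1, t)\<bar>) \<le> pi * ((norm k * (1 + \<bar>t\<bar>)) * \<bar>K (1, t)\<bar>)"
        by (intro mult_left_mono mult_right_mono kt) auto
      then show "norm (pi * (\<bar>fst k + snd k * t\<bar> * K (1, t)))
        \<le> norm (pi * (norm k * ((1 + \<bar>t\<bar>) * \<bar>K (1, t)\<bar>)))"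
        by (simp add: abs_mult mult.assoc)
    qed
  qed measurable
  have "(\<integral>y. (1 - cos (k \<bullet> y)) * K y \<partial>lborel) = (\<integral>t. pi * (\<bar>fst k + snd k * t\<bar> * K (1, t)) \<partial>lborel)"
    using nn_integral_homogeneous_kernel[OF K, of k] nn_integral_homogeneous_kernel[OF K'(2), of k]
    unfolding real_lebesgue_integral_def[OF 1] real_lebesgue_integral_def[OF 2] by simp
  then show "(\<integral>y. (1 - cos (k \<bullet> y)) * K y \<partial>lborel)
      = pi * (\<integral>t. \<bar>fst k + snd k * t\<bar> * K (1, t) \<partial>lborel)" by simp
qed

section \<open>Twice continuously differentiable functions\<close>

text \<open>The derivatives are arguments because the second derivative itself is the object of interest: it
will be the kernel. The predicate \<open>twice_cont_diff\<close> below hides them.\<close>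

definition C2 :: "(real \<Rightarrow> real) \<Rightarrow> (real \<Rightarrow> real) \<Rightarrow> (real \<Rightarrow> real) \<Rightarrow> bool" where
  "C2 f f1 f2 \<longleftrightarrow> (\<forall>t. (f has_real_derivative f1 t) (at t)) \<and>
     (\<forall>t. (f1 has_real_derivative f2 t) (at t)) \<and> continuous_on UNIV f2"

lemma C2D:
  assumes "C2 f f1 f2"
  shows "(f has_real_derivative f1 t) (at t)" "(f1 has_real_derivative f2 t) (at t)" "isCont f2 t"
    "isCont f t" "isCont f1 t"
  using assms by (auto simp: C2_def continuous_on_eq_continuous_at intro: DERIV_isCont)

lemma C2_const: "C2 (\<lambda>_. c) (\<lambda>_. 0) (\<lambda>_. 0)"
  by (auto simp: C2_def)

lemma C2_ident: "C2 (\<lambda>t. t) (\<lambda>_. 1) (\<lambda>_. 0)"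
  by (auto simp: C2_def)

lemma C2_add:
  assumes "C2 f f1 f2" "C2 g g1 g2"
  shows "C2 (\<lambda>t. f t + g t) (\<lambda>t. f1 t + g1 t) (\<lambda>t. f2 t + g2 t)"
  using assms by (auto simp: C2_def intro!: derivative_intros continuous_intros)

lemma C2_mult:
  assumes "C2 f f1 f2" "C2 g g1 g2"
  shows "C2 (\<lambda>t. f t * g t) (\<lambda>t. f1 t * g t + g1 t * f t)
           (\<lambda>t. (f2 t * g t + g1 t * f1 t) + (g2 t * f t + f1 t * g1 t))"
  unfolding C2_def continuous_on_eq_continuous_at[OF open_UNIV]
  by (intro conjI allI ballI DERIV_mult DERIV_add continuous_intros C2D[OF assms(1)] C2D[OF assms(2)])

lemma C2_compose:
  assumes "C2 f f1 f2" and F: "\<And>t. (F has_real_derivative DF (f t)) (at (f t))"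
    "\<And>t. (DF has_real_derivative DDF (f t)) (at (f t))" "\<And>t. isCont DDF (f t)"
  shows "C2 (\<lambda>t. F (f t)) (\<lambda>t. DF (f t) * f1 t) (\<lambda>t. (DDF (f t) * f1 t) * f1 t + f2 t * DF (f t))"
  unfolding C2_def continuous_on_eq_continuous_at[OF open_UNIV]
proof (intro conjI allI ballI)
  fix t
  note f = C2D[OF assms(1), of t]
  show "((\<lambda>t. F (f t)) has_real_derivative DF (f t) * f1 t) (at t)"
    by (rule DERIV_chain2[of F, OF F(1) f(1)])
  show "((\<lambda>t. DF (f t) * f1 t) has_real_derivative DDF (f t) * f1 t * f1 t + f2 t * DF (f t)) (at t)"
    by (rule DERIV_mult[OF DERIV_chain2[of DF, OF F(2) f(1)] f(2)])
  show "isCont (\<lambda>t. DDF (f t) * f1 t * f1 t + f2 t * DF (f t)) t"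
    by (intro continuous_intros f isCont_o2[OF f(4) F(3)] isCont_o2[OF f(4) DERIV_isCont[OF F(2)]])
qed

lemma C2_inverse:
  assumes "C2 f f1 f2" "\<And>t. f t \<noteq> 0"
  shows "\<exists>g1 g2. C2 (\<lambda>t. inverse (f t)) g1 g2"
proof -
  have "C2 (\<lambda>t. inverse (f t)) (\<lambda>t. - (inverse (f t))\<^sup>2 * f1 t)
      (\<lambda>t. (2 * (inverse (f t)) ^ 3 * f1 t) * f1 t + f2 t * - (inverse (f t))\<^sup>2)"
    using assms(2)
    by (intro C2_compose[where DF="\<lambda>x. - (inverse x)\<^sup>2" and DDF="\<lambda>x. 2 * (inverse x) ^ 3"]
        assms(1)) (auto intro!: derivative_eq_intros continuous_intros simp: power2_eq_square power3_eq_cube)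
  then show ?thesis by blast
qed

lemma C2_sqrt:
  assumes "C2 f f1 f2" "\<And>t. f t > 0"
  shows "\<exists>g1 g2. C2 (\<lambda>t. sqrt (f t)) g1 g2"
proof -
  have "C2 (\<lambda>t. sqrt (f t)) (\<lambda>t. (inverse (sqrt (f t)) / 2) * f1 t)
      (\<lambda>t. ((- ((inverse (sqrt (f t))) ^ 3) / 4) * f1 t) * f1 t + f2 t * (inverse (sqrt (f t)) / 2))"
  proof (rule C2_compose[where DF="\<lambda>x. inverse (sqrt x) / 2" and DDF="\<lambda>x. - ((inverse (sqrt x)) ^ 3) / 4"])
    fix t
    have "((\<lambda>x. inverse (sqrt x)) has_real_derivative
       - (inverse (sqrt (f t)) * (inverse (sqrt (f t)) / 2) * inverse (sqrt (f t)))) (at (f t))"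
      using assms(2)[of t] by (intro DERIV_inverse' DERIV_real_sqrt) auto
    from DERIV_cdivide[OF this, of 2]
    show "((\<lambda>x. inverse (sqrt x) / 2) has_real_derivative - ((inverse (sqrt (f t))) ^ 3) / 4) (at (f t))"
      by (rule DERIV_cong) (simp add: power3_eq_cube)
  qed (use assms(2) in \<open>auto intro!: derivative_eq_intros DERIV_real_sqrt continuous_intros simp: less_imp_neq[symmetric] C2D assms(1)\<close>)
  then show ?thesis by blast
qed

text \<open>Identifies the second derivative from a formula for \<open>f\<close> that is valid only locally, as happens for
the rationalized symbol away from the zeros of the quartic.\<close>

lemma second_derivative_unique:
  assumes "C2 f f1 f2" "open U" "t \<in> U"
    and "\<And>s. s \<in> U \<Longrightarrow> f s = F s" "\<And>s. s \<in> U \<Longrightarrow> (F has_real_derivative F1 s) (at s)"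
    and "(F1 has_real_derivative D) (at t)"
  shows "f1 t = F1 t" "f2 t = D"
proof -
  have *: "f1 s = F1 s" if "s \<in> U" for s
  proof -
    have "(F has_real_derivative f1 s) (at s)"
      using has_field_derivative_transform_within_open[OF C2D(1)[OF assms(1)] assms(2) that assms(4)] .
    with assms(5)[OF that] show ?thesis by (rule DERIV_unique[symmetric])
  qed
  then show "f1 t = F1 t" using assms(3) by blast
  have "(F1 has_real_derivative f2 t) (at t)"
    using has_field_derivative_transform_within_open[OF C2D(2)[OF assms(1)] assms(2,3) *] .
  then show "f2 t = D" using assms(6) by (rule DERIV_unique)
qed

lemma C2_even:
  assumes "C2 f f1 f2" and "\<And>t. f (- t) = f t"
  shows "f1 (- t) = - f1 t" "f2 (- t) = f2 t"
proof -
  have 1: "((\<lambda>s. f (- s)) has_real_derivative - f1 (- s)) (at s)" for s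
    using DERIV_chain2[OF C2D(1)[OF assms(1)] DERIV_minus[OF DERIV_ident]] by (auto elim!: DERIV_cong)
  have 2: "((\<lambda>s. - f1 (- s)) has_real_derivative f2 (- t)) (at t)"
    using DERIV_minus[OF DERIV_chain2[OF C2D(2)[OF assms(1)] DERIV_minus[OF DERIV_ident]]]
    by (auto elim!: DERIV_cong)
  show "f1 (- t) = - f1 t" "f2 (- t) = f2 t"
    using second_derivative_unique[OF assms(1) open_UNIV _ _ 1 2] assms(2) by (auto simp: minus_equation_iff)
qed

section \<open>Recovering a function from its second derivative\<close>

lemma integrable_inverse_square: "integrable lborel (\<lambda>t::real. inverse (1 + t\<^sup>2))"
  using integrable_inverse_1_plus_square by (simp add: set_integrable_def)

text \<open>The restrictions \<open>g(t) = m(t, 1)\<close> and \<open>h(t) = m(1, t)\<close> of a function \<open>m\<close> that is homogeneous of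
degree \<open>1\<close> and even in each variable. The regularity of \<open>h\<close> at \<open>0\<close> controls \<open>g\<close> at infinity: there
\<open>g\<close> is asymptotic to \<open>h(0) \<bar>t\<bar>\<close> without constant term.\<close>

locale profile =
  fixes g g1 g2 h h1 h2 :: "real \<Rightarrow> real"
  assumes g: "C2 g g1 g2" and h: "C2 h h1 h2"
    and even_g: "\<And>t. g (- t) = g t" and even_h: "\<And>t. h (- t) = h t"
    and gh: "\<And>t. t > 0 \<Longrightarrow> g t = t * h (1 / t)"
begin

lemma g_pos:
  assumes "t > 0"
  shows "g1 t = h (1 / t) - h1 (1 / t) / t" "g2 t = h2 (1 / t) / t ^ 3"
proof -
  have d1: "((\<lambda>t. t * h (1 / t)) has_real_derivative h (1 / s) - h1 (1 / s) / s) (at s)"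
    if "s \<in> {0<..}" for s
    using that
    by (auto intro!: derivative_eq_intros DERIV_chain2[OF C2D(1)[OF h]] simp: field_simps power2_eq_square)
  have d2: "((\<lambda>t. h (1 / t) - h1 (1 / t) / t) has_real_derivative h2 (1 / t) / t ^ 3) (at t)"
    using assms
    by (auto intro!: derivative_eq_intros DERIV_chain2[OF C2D(1)[OF h]] DERIV_chain2[OF C2D(2)[OF h]]
        simp: field_simps power2_eq_square power3_eq_cube)
  show "g1 t = h (1 / t) - h1 (1 / t) / t" "g2 t = h2 (1 / t) / t ^ 3"
    using second_derivative_unique[OF g open_greaterThan[of 0] _ gh d1 d2] assms by auto
qed

lemma h1_0: "h1 0 = 0"
  using C2_even(1)[OF h even_h, of 0] by simp

lemma g1_at_top: "(g1 \<longlongrightarrow> h 0) at_top"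
proof -
  have i: "((\<lambda>t::real. 1 / t) \<longlongrightarrow> 0) at_top" by real_asymp
  have "((\<lambda>t. h (1 / t) - h1 (1 / t) * (1 / t)) \<longlongrightarrow> h 0 - h1 0 * 0) at_top"
    by (intro tendsto_intros isCont_tendsto_compose[OF C2D(4)[OF h]] isCont_tendsto_compose[OF C2D(5)[OF h]] i)
  then have "((\<lambda>t. h (1 / t) - h1 (1 / t) * (1 / t)) \<longlongrightarrow> h 0) at_top" by simp
  then show ?thesis
    by (rule Lim_transform_eventually) (use eventually_gt_at_top[of 0] in eventually_elim, simp add: g_pos)
qed

text \<open>The intercept at \<open>0\<close> of the tangent to \<open>g\<close> at \<open>t\<close>, up to sign, is \<open>- h'(1 / t)\<close>. It tends to
\<open>- h'(0)\<close>, which vanishes since \<open>h\<close> is even. Hence \<open>g2_dist\<close> has no constant of integration.\<close>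

lemma g1_defect_at_top: "((\<lambda>t. t * g1 t - g t) \<longlongrightarrow> 0) at_top"
proof -
  have i: "((\<lambda>t::real. 1 / t) \<longlongrightarrow> 0) at_top" by real_asymp
  have "((\<lambda>t. - h1 (1 / t)) \<longlongrightarrow> - h1 0) at_top"
    by (intro tendsto_intros isCont_tendsto_compose[OF C2D(5)[OF h]] i)
  then have "((\<lambda>t. - h1 (1 / t)) \<longlongrightarrow> 0) at_top" by (simp add: h1_0)
  then show ?thesis
    by (rule Lim_transform_eventually)
       (use eventually_gt_at_top[of 0] in eventually_elim, simp add: g_pos gh field_simps)
qed

lemma g1_at_bot: "(g1 \<longlongrightarrow> - h 0) at_bot"
  using tendsto_minus[OF g1_at_top] C2_even(1)[OF g even_g] by (simp add: filterlim_at_bot_mirror)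

lemma g1_defect_at_bot: "((\<lambda>t. t * g1 t - g t) \<longlongrightarrow> 0) at_bot"
  using g1_defect_at_top C2_even(1)[OF g even_g] even_g by (simp add: filterlim_at_bot_mirror)

text \<open>By \<open>g_pos\<close> the second derivative of \<open>g\<close> is \<open>h''(1 / t) / t\<^sup>3\<close>, so that the integrand decays like
\<open>1 / t\<^sup>2\<close>.\<close>

lemma integrable_g2: "integrable lborel (\<lambda>t. (1 + \<bar>t\<bar>) * g2 t)"
proof -
  have c2: "continuous_on S g2" "continuous_on S h2" for S
    using C2D(3)[OF g] C2D(3)[OF h] by (auto intro: continuous_at_imp_continuous_on)
  have "bounded (g2 ` {-1..1})" "bounded (h2 ` {-1..1})"
    by (intro compact_imp_bounded compact_continuous_image c2 compact_Icc)+
  then obtain B1 B2 where B: "\<And>t. t \<in> {-1..1} \<Longrightarrow> \<bar>g2 t\<bar> \<le> B1" "\<And>t. t \<in> {-1..1} \<Longrightarrow> \<bar>h2 t\<bar> \<le> B2"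
    unfolding bounded_iff by (metis image_eqI real_norm_def)
  define M where "M = max B1 B2"
  have M: "\<And>t. t \<in> {-1..1} \<Longrightarrow> \<bar>g2 t\<bar> \<le> M" "\<And>t. t \<in> {-1..1} \<Longrightarrow> \<bar>h2 t\<bar> \<le> M"
    using B unfolding M_def by force+
  have M0: "M \<ge> 0" using M(1)[of 0] by auto
  \<comment> \<open>The constant \<open>4\<close> serves both ranges: \<open>1 + \<bar>t\<bar> \<le> 2\<close> and \<open>1 + t\<^sup>2 \<le> 2\<close> inside, \<open>1 + s \<le> 2 s\<close> and \<open>1 + s\<^sup>2 \<le> 2 s\<^sup>2\<close> outside.\<close>
  have bound: "(1 + \<bar>t\<bar>) * \<bar>g2 t\<bar> \<le> 4 * M * inverse (1 + t\<^sup>2)" for t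
  proof (cases "\<bar>t\<bar> \<le> 1")
    case True
    have "(1 + \<bar>t\<bar>) * \<bar>g2 t\<bar> \<le> 2 * M"
      using True by (intro mult_mono M(1)) auto
    also have "\<dots> = 4 * M * inverse 2" by simp
    also have "\<dots> \<le> 4 * M * inverse (1 + t\<^sup>2)"
      using True M0 abs_square_le_1[of t] by (intro mult_left_mono le_imp_inverse_le) (auto intro: add_pos_nonneg)
    finally show ?thesis .
  next
    case False
    define s where "s = \<bar>t\<bar>"
    have s: "s > 1" using False by (simp add: s_def)
    have "g2 t = g2 s" using C2_even(2)[OF g even_g, of t] by (simp add: s_def abs_if)
    then have "\<bar>g2 t\<bar> = \<bar>h2 (1 / s)\<bar> / s ^ 3" using g_pos(2)[of s] s by (simp add: abs_divide)
    also have "\<dots> \<le> M / s ^ 3"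
      using M(2)[of "1 / s"] s by (intro divide_right_mono) (auto simp: field_simps)
    finally have "(1 + s) * \<bar>g2 t\<bar> \<le> (1 + s) * (M / s ^ 3)"
      using s by (intro mult_left_mono) auto
    also have "\<dots> \<le> (2 * s) * (M / s ^ 3)" using s M0 by (intro mult_right_mono) auto
    also have "\<dots> = 4 * M * inverse (s\<^sup>2 + s\<^sup>2)"
      using s by (simp add: field_simps power2_eq_square power3_eq_cube)
    also have "\<dots> \<le> 4 * M * inverse (1 + s\<^sup>2)"
      using s M0 one_le_power[of s 2] by (intro mult_left_mono le_imp_inverse_le) (auto intro: add_pos_nonneg)
    finally show ?thesis by (simp add: s_def)
  qed
  have "integrable lborel (\<lambda>t. 4 * M * inverse (1 + t\<^sup>2))"
    using integrable_inverse_square by simp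
  then show ?thesis
  proof (rule Bochner_Integration.integrable_bound)
    show "(\<lambda>t. (1 + \<bar>t\<bar>) * g2 t) \<in> borel_measurable lborel"
      using borel_measurable_continuous_onI[OF c2(1)] by simp
    show "AE t in lborel. norm ((1 + \<bar>t\<bar>) * g2 t) \<le> norm (4 * M * inverse (1 + t\<^sup>2))"
      using bound M0 by (intro AE_I2) (auto simp: abs_mult add_pos_nonneg)
  qed
qed

lemma integrable_g2_dist: "integrable lborel (\<lambda>t. \<bar>a + b * t\<bar> * g2 t)"
proof (rule Bochner_Integration.integrable_bound)
  show "integrable lborel (\<lambda>t. (\<bar>a\<bar> + \<bar>b\<bar>) * ((1 + \<bar>t\<bar>) * g2 t))"
    using integrable_g2 by simp
  have [measurable]: "g2 \<in> borel_measurable borel"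
    using C2D(3)[OF g] by (auto intro: borel_measurable_continuous_onI continuous_at_imp_continuous_on)
  show "(\<lambda>t. \<bar>a + b * t\<bar> * g2 t) \<in> borel_measurable lborel" by measurable
  have "\<bar>a + b * t\<bar> \<le> (\<bar>a\<bar> + \<bar>b\<bar>) * (1 + \<bar>t\<bar>)" for t
  proof -
    have "\<bar>a + b * t\<bar> \<le> \<bar>a\<bar> + \<bar>b\<bar> * \<bar>t\<bar>" by (metis abs_triangle_ineq abs_mult)
    also have "\<dots> \<le> (\<bar>a\<bar> + \<bar>b\<bar>) * (1 + \<bar>t\<bar>)" by (simp add: algebra_simps)
    finally show ?thesis .
  qed
  then show "AE t in lborel. norm (\<bar>a + b * t\<bar> * g2 t) \<le> norm ((\<bar>a\<bar> + \<bar>b\<bar>) * ((1 + \<bar>t\<bar>) * g2 t))"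
    by (intro AE_I2) (auto simp: abs_mult mult.assoc[symmetric] intro!: mult_right_mono)
qed

lemma g2_total: "(\<integral>t. g2 t \<partial>lborel) = 2 * h 0"
proof -
  have "(LBINT t=-\<infinity>..\<infinity>. g2 t) = h 0 - (- h 0)"
  proof (rule interval_integral_FTC_integrable[where F=g1])
    show "(g1 has_vector_derivative g2 x) (at x)" for x
      using C2D(2)[OF g] by (simp add: has_real_derivative_iff_has_vector_derivative)
    show "set_integrable lborel (einterval (- \<infinity>) \<infinity>) g2"
      using integrable_g2_dist[of 1 0] by (simp add: set_integrable_def)
  qed (use C2D(3)[OF g] g1_at_top g1_at_bot in \<open>auto simp: ereal_tendsto_simps\<close>)
  then show ?thesis by (simp add: interval_lebesgue_integral_def set_lebesgue_integral_def)
qed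

text \<open>Half the distance \<open>\<bar>t - a\<bar>\<close> is a fundamental solution of the second derivative. The asymptotes
\<open>\<plusminus> h(0) t\<close> of \<open>g\<close> contribute \<open>- a h(0)\<close> and \<open>a h(0)\<close> at the two ends, which cancel.\<close>

lemma g2_dist: "(\<integral>t. \<bar>t - a\<bar> * g2 t \<partial>lborel) = 2 * g a"
proof -
  \<comment> \<open>An antiderivative of \<open>(t - a) g''(t)\<close>, from integration by parts.\<close>
  define F where "F = (\<lambda>t. g1 t * (t - a) - g t)"
  have F: "(F has_vector_derivative (t - a) * g2 t) (at t)" for t
    unfolding F_def has_real_derivative_iff_has_vector_derivative[symmetric]
    by (auto intro!: derivative_eq_intros C2D[OF g])
  have int: "integrable lborel (\<lambda>t. \<bar>t - a\<bar> * g2 t)"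
    using integrable_g2_dist[of "- a" 1] by (simp add: algebra_simps)
  have sint: "set_integrable lborel (einterval x y) (\<lambda>t. \<bar>t - a\<bar> * g2 t)" for x y
    using int unfolding set_integrable_def by (intro integrable_mult_indicator) auto
  have top: "(F \<longlongrightarrow> - a * h 0) at_top"
    using tendsto_diff[OF g1_defect_at_top tendsto_mult_left[OF g1_at_top, of a]]
    by (simp add: F_def algebra_simps)
  have bot: "(F \<longlongrightarrow> a * h 0) at_bot"
    using tendsto_diff[OF g1_defect_at_bot tendsto_mult_left[OF g1_at_bot, of a]]
    by (simp add: F_def algebra_simps)
  have Fa: "isCont F a" using F by (rule has_vector_derivative_continuous)
  have "(LBINT t=a..\<infinity>. \<bar>t - a\<bar> * g2 t) = - a * h 0 - F a"
  proof (rule interval_integral_FTC_integrable[where F=F, OF _ _ _ sint])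
    show "(F has_vector_derivative \<bar>x - a\<bar> * g2 x) (at x)" if "ereal a < ereal x" for x
      using F[of x] that by simp
    show "((F \<circ> real_of_ereal) \<longlongrightarrow> F a) (at_right (ereal a))"
      using Fa by (auto simp: ereal_tendsto_simps isCont_def intro: tendsto_mono[OF at_le])
    show "((F \<circ> real_of_ereal) \<longlongrightarrow> - a * h 0) (at_left \<infinity>)"
      using top by (simp add: ereal_tendsto_simps)
  qed (auto intro!: continuous_intros C2D(3)[OF g])
  moreover have "(LBINT t=-\<infinity>..a. \<bar>t - a\<bar> * g2 t) = - F a - (- (a * h 0))"
  proof (rule interval_integral_FTC_integrable[where F="\<lambda>t. - F t", OF _ _ _ sint])
    show "((\<lambda>t. - F t) has_vector_derivative \<bar>x - a\<bar> * g2 x) (at x)" if "ereal x < ereal a" for x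
      using has_vector_derivative_minus[OF F[of x]] that by (simp add: abs_if algebra_simps)
    show "(((\<lambda>t. - F t) \<circ> real_of_ereal) \<longlongrightarrow> - F a) (at_left (ereal a))"
      using tendsto_minus[of F "F a" "at_left a"] Fa
      by (auto simp: ereal_tendsto_simps isCont_def intro: tendsto_mono[OF at_le])
    show "(((\<lambda>t. - F t) \<circ> real_of_ereal) \<longlongrightarrow> - (a * h 0)) (at_right (- \<infinity>))"
      using tendsto_minus[OF bot] by (simp add: ereal_tendsto_simps)
  qed (auto intro!: continuous_intros C2D(3)[OF g])
  moreover have "(LBINT t=-\<infinity>..a. \<bar>t - a\<bar> * g2 t) + (LBINT t=a..\<infinity>. \<bar>t - a\<bar> * g2 t)
      = (LBINT t=-\<infinity>..\<infinity>. \<bar>t - a\<bar> * g2 t)"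
    using sint[of "- \<infinity>" \<infinity>] by (intro interval_integral_sum) (simp add: interval_lebesgue_integrable_def)
  ultimately show ?thesis
    by (simp add: interval_lebesgue_integral_def set_lebesgue_integral_def F_def)
qed

end

section \<open>The kernel as the second derivative of the symbol\<close>

text \<open>Both terms of the rationalized symbol have this shape. The numerator of the second derivative is
arranged so that it becomes a polynomial over the common denominator \<open>(1 + e t\<^sup>2)\<^bsup>3/2\<^esup> Q\<^sup>3\<close>, the
denominator of \<open>K\<^sub>1\<close> and \<open>K\<^sub>2\<close>.\<close>

lemma sqrt_quotient_derivatives:
  fixes e t :: real
  assumes e: "e \<ge> 0" and Q0: "Q t \<noteq> 0"
    and P: "\<And>t. (P has_real_derivative P1 t) (at t)" "\<And>t. (P1 has_real_derivative P2 t) (at t)"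
    and Q: "\<And>t. (Q has_real_derivative Q1 t) (at t)" "\<And>t. (Q1 has_real_derivative Q2 t) (at t)"
  defines "S \<equiv> \<lambda>t. sqrt (1 + e * t\<^sup>2)"
  shows "((\<lambda>t. P t * S t / Q t) has_real_derivative
      (P1 t * Q t - P t * Q1 t) * S t / (Q t)\<^sup>2 + e * t * P t / (S t * Q t)) (at t)"
    and "((\<lambda>t. (P1 t * Q t - P t * Q1 t) * S t / (Q t)\<^sup>2 + e * t * P t / (S t * Q t)) has_real_derivative
      ((P2 t * (Q t)\<^sup>2 - 2 * P1 t * Q1 t * Q t - P t * Q2 t * Q t + 2 * P t * (Q1 t)\<^sup>2) * (1 + e * t\<^sup>2)\<^sup>2
       + 2 * e * t * Q t * (P1 t * Q t - P t * Q1 t) * (1 + e * t\<^sup>2) + e * P t * (Q t)\<^sup>2)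
      / ((1 + e * t\<^sup>2) powr (3 / 2) * (Q t) ^ 3)) (at t)"
proof -
  have R: "1 + e * t\<^sup>2 > 0" for t using e by (auto intro: add_pos_nonneg)
  have S2: "S t * S t = 1 + e * t\<^sup>2" for t using R[of t] by (simp add: S_def)
  have S0: "S t \<noteq> 0" for t using R[of t] by (simp add: S_def)
  have S3: "(1 + e * t\<^sup>2) powr (3 / 2) = S t * S t * S t"
  proof -
    have "(1 + e * t\<^sup>2) powr (3 / 2) = (1 + e * t\<^sup>2) powr 1 * (1 + e * t\<^sup>2) powr (1 / 2)"
      by (subst powr_add[symmetric]) simp
    then show ?thesis using R[of t] S2[of t] by (simp add: powr_half_sqrt S_def)
  qed
  have dS: "(S has_real_derivative e * t / S t) (at t)" for t
    unfolding S_def using R[of t] by (auto intro!: derivative_eq_intros simp: field_simps)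
  note [derivative_intros] = DERIV_chain2[of S, OF dS] DERIV_chain2[of P, OF P(1)] DERIV_chain2[of P1, OF P(2)]
     DERIV_chain2[of Q, OF Q(1)] DERIV_chain2[of Q1, OF Q(2)]
  show "((\<lambda>t. P t * S t / Q t) has_real_derivative
      (P1 t * Q t - P t * Q1 t) * S t / (Q t)\<^sup>2 + e * t * P t / (S t * Q t)) (at t)"
    using Q0 S0[of t]
    by (auto intro!: derivative_eq_intros simp: power2_eq_square divide_simps) (simp add: algebra_simps)
  let ?W = "P2 t * (Q t)\<^sup>2 - 2 * P1 t * Q1 t * Q t - P t * Q2 t * Q t + 2 * P t * (Q1 t)\<^sup>2"
  let ?A = "P1 t * Q t - P t * Q1 t"
  have "((\<lambda>t. (P1 t * Q t - P t * Q1 t) * S t / (Q t)\<^sup>2) has_real_derivative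
       (?W * S t + ?A * Q t * (e * t / S t)) / (Q t) ^ 3) (at t)"
    using Q0 S0[of t]
    by (auto intro!: derivative_eq_intros simp: divide_simps) algebra
  moreover have "((\<lambda>t. e * t * P t / (S t * Q t)) has_real_derivative
       (e * P t * Q t * (S t * S t - e * t * t) + e * t * ?A * (S t * S t)) / (S t * S t * S t * (Q t)\<^sup>2)) (at t)"
    using Q0 S0[of t]
    by (auto intro!: derivative_eq_intros simp: divide_simps) algebra
  ultimately have "((\<lambda>t. (P1 t * Q t - P t * Q1 t) * S t / (Q t)\<^sup>2 + e * t * P t / (S t * Q t)) has_real_derivative
     (?W * S t + ?A * Q t * (e * t / S t)) / (Q t) ^ 3 +
     (e * P t * Q t * (S t * S t - e * t * t) + e * t * ?A * (S t * S t)) / (S t * S t * S t * (Q t)\<^sup>2)) (at t)"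
    by (rule DERIV_add)
  then show "((\<lambda>t. (P1 t * Q t - P t * Q1 t) * S t / (Q t)\<^sup>2 + e * t * P t / (S t * Q t)) has_real_derivative
      (?W * (1 + e * t\<^sup>2)\<^sup>2
       + 2 * e * t * Q t * ?A * (1 + e * t\<^sup>2) + e * P t * (Q t)\<^sup>2)
      / ((1 + e * t\<^sup>2) powr (3 / 2) * (Q t) ^ 3)) (at t)"
  proof (rule DERIV_cong)
    have SS: "S t * S t - e * t * t = 1" using S2[of t] by (simp add: power2_eq_square)
    show "(?W * S t + ?A * Q t * (e * t / S t)) / (Q t) ^ 3 +
     (e * P t * Q t * (S t * S t - e * t * t) + e * t * ?A * (S t * S t)) / (S t * S t * S t * (Q t)\<^sup>2)
     = (?W * (1 + e * t\<^sup>2)\<^sup>2 + 2 * e * t * Q t * ?A * (1 + e * t\<^sup>2) + e * P t * (Q t)\<^sup>2)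
      / ((1 + e * t\<^sup>2) powr (3 / 2) * (Q t) ^ 3)"
      unfolding S3 SS unfolding S2[symmetric] using Q0 S0[of t]
      by (simp add: divide_simps) algebra
  qed
qed

definition twice_cont_diff :: "(real \<Rightarrow> real) \<Rightarrow> bool" where
  "twice_cont_diff f \<longleftrightarrow> (\<exists>f1 f2. C2 f f1 f2)"

lemma twice_cont_diff_intros:
  "twice_cont_diff (\<lambda>_. c)" "twice_cont_diff (\<lambda>t. t)"
  "twice_cont_diff f \<Longrightarrow> twice_cont_diff g \<Longrightarrow> twice_cont_diff (\<lambda>t. f t + g t)"
  "twice_cont_diff f \<Longrightarrow> twice_cont_diff g \<Longrightarrow> twice_cont_diff (\<lambda>t. f t * g t)"
  "twice_cont_diff f \<Longrightarrow> (\<And>t. f t \<noteq> 0) \<Longrightarrow> twice_cont_diff (\<lambda>t. inverse (f t))"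
  "twice_cont_diff f \<Longrightarrow> (\<And>t. f t > 0) \<Longrightarrow> twice_cont_diff (\<lambda>t. sqrt (f t))"
  unfolding twice_cont_diff_def
  using C2_const C2_ident C2_add[of f _ _ g] C2_mult[of f _ _ g] C2_inverse[of f] C2_sqrt[of f] by blast+

text \<open>Both square roots are at least \<open>\<bar>x\<bar>\<close>, so their product exceeds \<open>\<nu> x\<^sup>2\<close>; for \<open>x = 0\<close> the product
itself is positive.\<close>

lemma symbol_parts_pos:
  fixes \<delta> \<nu> x y :: real
  assumes "0 < \<delta>" "\<nu> < 1" "x \<noteq> 0 \<or> y \<noteq> 0"
  shows "x\<^sup>2 + y\<^sup>2 / \<delta> > 0" "x\<^sup>2 + y\<^sup>2 > 0" "sqrt (x\<^sup>2 + y\<^sup>2 / \<delta>) * sqrt (x\<^sup>2 + y\<^sup>2) - \<nu> * x\<^sup>2 > 0"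
proof -
  show 1: "x\<^sup>2 + y\<^sup>2 / \<delta> > 0" "x\<^sup>2 + y\<^sup>2 > 0"
    using assms by (auto intro: add_pos_nonneg add_nonneg_pos)
  show "sqrt (x\<^sup>2 + y\<^sup>2 / \<delta>) * sqrt (x\<^sup>2 + y\<^sup>2) - \<nu> * x\<^sup>2 > 0"
  proof (cases "x = 0")
    case False
    have "\<bar>x\<bar> * \<bar>x\<bar> \<le> sqrt (x\<^sup>2 + y\<^sup>2 / \<delta>) * sqrt (x\<^sup>2 + y\<^sup>2)"
      using assms by (intro mult_mono real_le_rsqrt) auto
    moreover have "\<nu> * x\<^sup>2 < 1 * x\<^sup>2" using assms False by (intro mult_strict_right_mono) auto
    ultimately show ?thesis by (simp add: power2_eq_square)
  qed (use 1 in simp)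
qed

lemma twice_cont_diff_symbol:
  assumes "0 < \<delta>" "\<nu> < 1" and f: "twice_cont_diff x" "twice_cont_diff y"
    and nz: "\<And>t. x t \<noteq> 0 \<or> y t \<noteq> 0"
  shows "twice_cont_diff (\<lambda>t. symbol \<mu> \<delta> \<nu> (x t, y t))"
proof -
  note pos = symbol_parts_pos[OF assms(1,2) nz]
  have "twice_cont_diff (\<lambda>t. 2 * \<mu> * sqrt (x t * x t + y t * y t) * (par_p \<delta> \<nu> * (x t * x t) + y t * y t)
     * inverse (sqrt (x t * x t + y t * y t * inverse \<delta>) * sqrt (x t * x t + y t * y t) + (- \<nu>) * (x t * x t)))"
    by (intro twice_cont_diff_intros f)
       (use pos in \<open>simp_all add: power2_eq_square divide_inverse less_imp_neq[symmetric]\<close>)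
  then show ?thesis
    by (simp add: symbol_def Let_def power2_eq_square divide_inverse)
qed

lemma symbol_homogeneous:
  assumes "s \<noteq> 0"
  shows "symbol \<mu> \<delta> \<nu> (s * x, s * y) = \<bar>s\<bar> * symbol \<mu> \<delta> \<nu> (x, y)"
proof -
  have 1: "(s * x)\<^sup>2 + (s * y)\<^sup>2 / \<delta> = s\<^sup>2 * (x\<^sup>2 + y\<^sup>2 / \<delta>)" "(s * x)\<^sup>2 + (s * y)\<^sup>2 = s\<^sup>2 * (x\<^sup>2 + y\<^sup>2)"
     "par_p \<delta> \<nu> * (s * x)\<^sup>2 + (s * y)\<^sup>2 = s\<^sup>2 * (par_p \<delta> \<nu> * x\<^sup>2 + y\<^sup>2)"
    by (simp_all add: algebra_simps power_mult_distrib)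
  have 2: "\<bar>s\<bar> * sqrt u * (\<bar>s\<bar> * sqrt v) - \<nu> * (s * x)\<^sup>2 = s\<^sup>2 * (sqrt u * sqrt v - \<nu> * x\<^sup>2)" for u v
    by (simp add: algebra_simps power_mult_distrib) (simp add: power2_eq_square)
  show ?thesis
    unfolding symbol_def Let_def fst_conv snd_conv 1 real_sqrt_mult real_sqrt_abs 2
    using assms by simp
qed

lemma quartic_homogeneous: "quartic \<delta> \<nu> (s * x, s * y) = s ^ 4 * quartic \<delta> \<nu> (x, y)"
  unfolding quartic_def fst_conv snd_conv by algebra

lemma form12_homogeneous: "form12 A B C D E F G (s * x, s * y) = s ^ 12 * form12 A B C D E F G (x, y)"
  unfolding form12_def Let_def fst_conv snd_conv by algebra

lemma powr_homogeneous:
  fixes s r :: real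
  assumes "s \<noteq> 0" "r \<ge> 0"
  shows "(s\<^sup>2 * r) powr (3 / 2) = \<bar>s\<bar> ^ 3 * r powr (3 / 2)"
proof -
  have "(s\<^sup>2) powr (3 / 2) = \<bar>s\<bar> ^ 3"
  proof -
    have "(s\<^sup>2) powr (3 / 2) = (\<bar>s\<bar> powr 2) powr (3 / 2)" using assms by simp
    also have "\<dots> = \<bar>s\<bar> powr 3" by (simp only: powr_powr) simp
    finally show ?thesis using assms by simp
  qed
  then show ?thesis using assms by (simp add: powr_mult)
qed

lemma continuous_on_form12 [continuous_intros]:
  "continuous_on X u \<Longrightarrow> continuous_on X (\<lambda>x. form12 A B C D E F G (u x))"
  unfolding form12_def Let_def by (intro continuous_intros)

lemma continuous_on_quartic [continuous_intros]:
  "continuous_on X u \<Longrightarrow> continuous_on X (\<lambda>x. quartic \<delta> \<nu> (u x))"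
  unfolding quartic_def by (intro continuous_intros)

lemma borel_measurable_form12_quartic [measurable]:
  "form12 A B C D E F G \<in> borel_measurable borel" "quartic \<delta> \<nu> \<in> borel_measurable borel"
  "(fst :: real \<times> real \<Rightarrow> real) \<in> borel_measurable borel" "(snd :: real \<times> real \<Rightarrow> real) \<in> borel_measurable borel"
  by (intro borel_measurable_continuous_onI continuous_intros)+

lemma homogeneous_kernel_L_kernel:
  assumes "0 < \<delta>"
  shows "homogeneous_kernel (L_kernel \<mu> \<delta> \<nu>)"
  unfolding homogeneous_kernel_def
proof (intro conjI allI impI)
  show "L_kernel \<mu> \<delta> \<nu> \<in> borel_measurable borel"
    unfolding L_kernel_def[abs_def] K1_def[abs_def] K2_def[abs_def] Let_def by measurable
  fix s t :: real assume s: "s \<noteq> 0"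
  have d: "(fst (s * x, s * y))\<^sup>2 + d * (snd (s * x, s * y))\<^sup>2 = s\<^sup>2 * ((fst (x, y))\<^sup>2 + d * (snd (x, y))\<^sup>2)" for x y d
    by (simp add: algebra_simps power_mult_distrib)
  have d1: "(fst (s * x, s * y))\<^sup>2 + (snd (s * x, s * y))\<^sup>2 = s\<^sup>2 * ((fst (x, y))\<^sup>2 + (snd (x, y))\<^sup>2)" for x y
    by (simp add: algebra_simps power_mult_distrib)
  have p: "(s\<^sup>2 * ((fst (x, y))\<^sup>2 + \<delta> * (snd (x, y))\<^sup>2)) powr (3 / 2)
     = \<bar>s\<bar> ^ 3 * ((fst (x, y))\<^sup>2 + \<delta> * (snd (x, y))\<^sup>2) powr (3 / 2)" for x y
    using s assms by (intro powr_homogeneous) auto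
  have p1: "(s\<^sup>2 * ((fst (x, y))\<^sup>2 + (snd (x, y))\<^sup>2)) powr (3 / 2)
     = \<bar>s\<bar> ^ 3 * ((fst (x, y))\<^sup>2 + (snd (x, y))\<^sup>2) powr (3 / 2)" for x y
    using s by (intro powr_homogeneous) auto
  have q: "s ^ 12 * f / (\<bar>s\<bar> ^ 3 * a * (s ^ 4 * b) ^ 3) = (f / (a * b ^ 3)) / \<bar>s\<bar> ^ 3" for f a b
    using s by (simp add: power_mult_distrib flip: power_mult)
  have "K1 \<delta> \<nu> (s * 1, s * t) = K1 \<delta> \<nu> (1, t) / \<bar>s\<bar> ^ 3"
    unfolding K1_def Let_def form12_homogeneous quartic_homogeneous d p q ..
  moreover have "K2 \<delta> \<nu> (s * 1, s * t) = K2 \<delta> \<nu> (1, t) / \<bar>s\<bar> ^ 3"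
    unfolding K2_def Let_def form12_homogeneous quartic_homogeneous d1 p1 q ..
  ultimately show "L_kernel \<mu> \<delta> \<nu> (s, s * t) = L_kernel \<mu> \<delta> \<nu> (1, t) / \<bar>s\<bar> ^ 3"
    by (simp add: L_kernel_def add_divide_distrib distrib_left)
qed

text \<open>Expansion by the conjugate \<open>r\<^sub>1 r\<^sub>2 + \<nu> t\<^sup>2\<close>: the difference of squares \<open>r\<^sub>1\<^sup>2 r\<^sub>2\<^sup>2 - \<nu>\<^sup>2 t\<^sup>4\<close> is the
quartic divided by \<open>\<delta>\<close>, and each remaining term contains a single square root. For \<open>\<nu> < -1\<close> the
conjugate vanishes for some \<open>t\<close> although the symbol is regular there; these are the zeros of the
quartic.\<close>

lemma symbol_profile_rationalized:
  assumes "0 < \<delta>" "\<nu> < 1" "quartic \<delta> \<nu> (1, t) \<noteq> 0"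
  defines "p \<equiv> par_p \<delta> \<nu>"
  shows "symbol \<mu> \<delta> \<nu> (t, 1) = 2 * \<mu> * \<delta> *
    ((1 / sqrt \<delta>) * ((1 + p * t\<^sup>2) * (1 + t\<^sup>2) * sqrt (1 + \<delta> * t\<^sup>2) / quartic \<delta> \<nu> (1, t))
     + \<nu> * ((1 + p * t\<^sup>2) * t\<^sup>2 * sqrt (1 + 1 * t\<^sup>2) / quartic \<delta> \<nu> (1, t)))"
proof -
  define r1 r2 where "r1 = sqrt (t\<^sup>2 + 1 / \<delta>)" and "r2 = sqrt (1 + t\<^sup>2)"
  have pos: "r1 * r2 - \<nu> * t\<^sup>2 > 0"
    using symbol_parts_pos(3)[OF assms(1,2), of t 1] by (simp add: r1_def r2_def add.commute)
  have r1: "r1\<^sup>2 = t\<^sup>2 + 1 / \<delta>" and r2: "r2\<^sup>2 = 1 + t\<^sup>2"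
    using assms(1) by (simp_all add: r1_def r2_def)
  have e1: "sqrt (1 + \<delta> * t\<^sup>2) = sqrt \<delta> * r1"
    unfolding r1_def using assms(1) by (simp add: distrib_left add.commute flip: real_sqrt_mult)
  define Q where "Q = quartic \<delta> \<nu> (1, t)"
  have Q0: "Q \<noteq> 0" using assms(3) by (simp add: Q_def)
  have Q: "Q = \<delta> * ((r1 * r2 - \<nu> * t\<^sup>2) * (r1 * r2 + \<nu> * t\<^sup>2))"
  proof -
    have "(r1 * r2 - \<nu> * t\<^sup>2) * (r1 * r2 + \<nu> * t\<^sup>2) = r1\<^sup>2 * r2\<^sup>2 - (\<nu> * t\<^sup>2)\<^sup>2" by algebra
    then show ?thesis
      using assms(1) unfolding r1 r2 Q_def quartic_def par_b_def par_c_def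
      by (simp add: field_simps power2_eq_square power4_eq_xxxx)
  qed
  have "symbol \<mu> \<delta> \<nu> (t, 1) = 2 * \<mu> * r2 * (1 + p * t\<^sup>2) / (r1 * r2 - \<nu> * t\<^sup>2)"
    by (simp add: symbol_def Let_def r1_def r2_def p_def add.commute)
  also have "\<dots> = 2 * \<mu> * \<delta> * (1 + p * t\<^sup>2) * r2 * (r1 * r2 + \<nu> * t\<^sup>2) / Q"
    using pos Q Q0 assms(1) by (simp add: divide_simps)
  also have "\<dots> = 2 * \<mu> * \<delta> * (1 + p * t\<^sup>2) * (r1 * r2\<^sup>2 + \<nu> * t\<^sup>2 * r2) / Q"
    by (simp add: power2_eq_square algebra_simps)
  also have "\<dots> = 2 * \<mu> * \<delta> * ((1 / sqrt \<delta>) * ((1 + p * t\<^sup>2) * (1 + t\<^sup>2) * (sqrt \<delta> * r1) / Q)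
     + \<nu> * ((1 + p * t\<^sup>2) * t\<^sup>2 * r2 / Q))"
    unfolding r2 using Q0 assms(1) by (simp add: field_simps)
  finally show ?thesis by (simp add: e1 Q_def r2_def)
qed

text \<open>The left hand side is the numerator in \<open>sqrt_quotient_derivatives\<close>, with \<open>e = \<delta>\<close>, and the right
hand side is \<open>\<delta>\<close> times the numerator of \<open>K\<^sub>1\<close> at the point \<open>(1, t)\<close>. The identity holds for
independent \<open>p\<close>, \<open>b\<close>, \<open>c\<close> and \<open>e\<close>, which makes it a comparison of polynomial coefficients.\<close>

lemma form12_K1:
  fixes t p b c e :: real
  defines "P \<equiv> (1 + p * t\<^sup>2) * (1 + t\<^sup>2)" and "P1 \<equiv> 2 * (1 + p) * t + 4 * p * t ^ 3"
    and "P2 \<equiv> 2 * (1 + p) + 12 * p * t\<^sup>2"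
    and "Q \<equiv> 1 + b * t\<^sup>2 + c * t ^ 4" and "Q1 \<equiv> 2 * b * t + 4 * c * t ^ 3"
    and "Q2 \<equiv> 2 * b + 12 * c * t\<^sup>2" and "R \<equiv> 1 + e * t\<^sup>2"
  shows "(P2 * Q\<^sup>2 - 2 * P1 * Q1 * Q - P * Q2 * Q + 2 * P * Q1\<^sup>2) * R\<^sup>2
      + 2 * e * t * Q * (P1 * Q - P * Q1) * R + e * P * Q\<^sup>2
    = (- 2 * b + e + 2 * p + 2)
      + 3 * (2 * b\<^sup>2 - 2 * b * (e + p + 1) - 4 * c + 3 * e + 3 * e * p + 4 * p) * t\<^sup>2
      + (9 * b\<^sup>2 * e + 6 * c * (3 * b - 5 * e - 4 * p - 4)
              - 6 * b * (e\<^sup>2 + e + e * p - p) + 3 * e * (2 * e + 2 * e * p + 11 * p)) * t ^ 4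
      + ((b\<^sup>2 * (e * (2 * e + 1) + (e + 2) * p)
              - 2 * b * (c * (- 13 * e + p + 1) + e * (e + (e - 13) * p)))
             + (20 * c\<^sup>2 - 2 * c * (e * (10 * e + 23) + (23 * e + 10) * p)
                + 20 * e\<^sup>2 * p)) * t ^ 6
      + (- 6 * c * (b * (- e\<^sup>2 + e + e * p + p) + e * (4 * e + 4 * e * p + 5 * p))
              + 9 * b * e * p * (b + 2 * e) + c\<^sup>2 * (33 * e + 6 * p + 6)) * t ^ 8
      + e * (6 * b\<^sup>2 * e * p - 6 * c * (b * (e + e * p + p) + 2 * e * p)
             + 3 * c\<^sup>2 * (4 * e + 3 * p + 3)) * t ^ 10
      + e * (c * (c * (2 * e + 2 * e * p + p) - 2 * b * e * p)) * t ^ 12"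
  unfolding assms by algebra

lemma form12_K2:
  fixes t p b c :: real
  defines "P \<equiv> (1 + p * t\<^sup>2) * t\<^sup>2" and "P1 \<equiv> 2 * t + 4 * p * t ^ 3"
    and "P2 \<equiv> 2 + 12 * p * t\<^sup>2"
    and "Q \<equiv> 1 + b * t\<^sup>2 + c * t ^ 4" and "Q1 \<equiv> 2 * b * t + 4 * c * t ^ 3"
    and "Q2 \<equiv> 2 * b + 12 * c * t\<^sup>2" and "R \<equiv> 1 + t\<^sup>2"
  shows "(P2 * Q\<^sup>2 - 2 * P1 * Q1 * Q - P * Q2 * Q + 2 * P * Q1\<^sup>2) * R\<^sup>2
      + 2 * t * Q * (P1 * Q - P * Q1) * R + P * Q\<^sup>2
    = 2 + (- 6 * b + 12 * p + 9) * t\<^sup>2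
      + (6 * b * (p - 1) - 24 * c + 33 * p + 6) * t ^ 4
      + (b\<^sup>2 - 2 * b * (c + 1) + 2 * (b + 13) * b * p - 20 * c * p - 46 * c + 20 * p) * t ^ 6
      + (- 6 * c * ((b + 5) * p + b + 4) + 9 * b * (b + 2) * p + 6 * c\<^sup>2) * t ^ 8
      + (6 * b\<^sup>2 * p - 6 * b * c * (p + 1) + 3 * c * (3 * c - 4 * p)) * t ^ 10
      + (c * (c * (p + 2) - 2 * b * p)) * t ^ 12"
  unfolding assms by algebra

lemma form12_divide:
  assumes "d \<noteq> 0"
  shows "form12 (A / d) (B / d) (C / d) (D / d + D' / d) (E / d) F G (1, t)
    = (A + B * t ^ 2 + C * t ^ 4 + (D + D') * t ^ 6 + E * t ^ 8 + d * F * t ^ 10 + d * G * t ^ 12) / d"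
  using assms by (simp add: form12_def field_simps)

text \<open>The two terms of \<open>symbol_profile_rationalized\<close> give \<open>K\<^sub>1\<close> and \<open>K\<^sub>2\<close>. The factor \<open>sqrt \<delta>\<close> of
\<open>K\<^sub>1\<close> is \<open>\<delta> / sqrt \<delta>\<close>, with \<open>\<delta>\<close> from \<open>form12_K1\<close> and \<open>1 / sqrt \<delta>\<close> from \<open>r\<^sub>1\<close>.\<close>

lemma L_kernel_is_second_derivative:
  assumes "0 < \<delta>" "\<nu> < 1" "quartic \<delta> \<nu> (1, t) \<noteq> 0"
    and g: "C2 (\<lambda>t. symbol \<mu> \<delta> \<nu> (t, 1)) g1 g2"
  shows "g2 t = L_kernel \<mu> \<delta> \<nu> (1, t)"
proof -
  define p b c where "p = par_p \<delta> \<nu>" and "b = par_b \<delta>" and "c = par_c \<delta> \<nu>"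
  define Q where "Q = (\<lambda>t::real. 1 + b * t\<^sup>2 + c * t ^ 4)"
  define Q1 where "Q1 = (\<lambda>t::real. 2 * b * t + 4 * c * t ^ 3)"
  define Q2 where "Q2 = (\<lambda>t::real. 2 * b + 12 * c * t\<^sup>2)"
  define P where "P = (\<lambda>t::real. (1 + p * t\<^sup>2) * (1 + t\<^sup>2))"
  define P1 where "P1 = (\<lambda>t::real. 2 * (1 + p) * t + 4 * p * t ^ 3)"
  define P2 where "P2 = (\<lambda>t::real. 2 * (1 + p) + 12 * p * t\<^sup>2)"
  define R where "R = (\<lambda>t::real. (1 + p * t\<^sup>2) * t\<^sup>2)"
  define R1 where "R1 = (\<lambda>t::real. 2 * t + 4 * p * t ^ 3)"
  define R2 where "R2 = (\<lambda>t::real. 2 + 12 * p * t\<^sup>2)"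
  have Q: "Q s = quartic \<delta> \<nu> (1, s)" for s by (simp add: Q_def quartic_def b_def c_def)
  have ders: "(Q has_real_derivative Q1 s) (at s)" "(Q1 has_real_derivative Q2 s) (at s)"
     "(P has_real_derivative P1 s) (at s)" "(P1 has_real_derivative P2 s) (at s)"
     "(R has_real_derivative R1 s) (at s)" "(R1 has_real_derivative R2 s) (at s)" for s
    unfolding Q_def Q1_def Q2_def P_def P1_def P2_def R_def R1_def R2_def
    by (auto intro!: derivative_eq_intros simp: power2_eq_square power3_eq_cube algebra_simps)
  define U where "U = {s. Q s \<noteq> 0}"
  have U: "open U" unfolding U_def Q_def by (intro open_Collect_neq continuous_intros)
  have tU: "t \<in> U" using assms(3) by (simp add: U_def Q)
  note dP = sqrt_quotient_derivatives[of \<delta> Q, OF _ _ ders(3,4,1,2)]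
  note dR = sqrt_quotient_derivatives[of 1 Q, OF _ _ ders(5,6,1,2)]
  let ?F = "\<lambda>s. 2 * \<mu> * \<delta> * ((1 / sqrt \<delta>) * (P s * sqrt (1 + \<delta> * s\<^sup>2) / Q s)
     + \<nu> * (R s * sqrt (1 + 1 * s\<^sup>2) / Q s))"
  let ?F1 = "\<lambda>s. 2 * \<mu> * \<delta> * ((1 / sqrt \<delta>) * ((P1 s * Q s - P s * Q1 s) * sqrt (1 + \<delta> * s\<^sup>2) / (Q s)\<^sup>2
       + \<delta> * s * P s / (sqrt (1 + \<delta> * s\<^sup>2) * Q s))
     + \<nu> * ((R1 s * Q s - R s * Q1 s) * sqrt (1 + 1 * s\<^sup>2) / (Q s)\<^sup>2
       + 1 * s * R s / (sqrt (1 + 1 * s\<^sup>2) * Q s)))"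
  let ?N1 = "(P2 t * (Q t)\<^sup>2 - 2 * P1 t * Q1 t * Q t - P t * Q2 t * Q t + 2 * P t * (Q1 t)\<^sup>2) * (1 + \<delta> * t\<^sup>2)\<^sup>2
       + 2 * \<delta> * t * Q t * (P1 t * Q t - P t * Q1 t) * (1 + \<delta> * t\<^sup>2) + \<delta> * P t * (Q t)\<^sup>2"
  let ?N2 = "(R2 t * (Q t)\<^sup>2 - 2 * R1 t * Q1 t * Q t - R t * Q2 t * Q t + 2 * R t * (Q1 t)\<^sup>2) * (1 + 1 * t\<^sup>2)\<^sup>2
       + 2 * 1 * t * Q t * (R1 t * Q t - R t * Q1 t) * (1 + 1 * t\<^sup>2) + 1 * R t * (Q t)\<^sup>2"
  have g2: "g2 t = 2 * \<mu> * \<delta> * ((1 / sqrt \<delta>) * (?N1 / ((1 + \<delta> * t\<^sup>2) powr (3 / 2) * (Q t) ^ 3))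
     + \<nu> * (?N2 / ((1 + 1 * t\<^sup>2) powr (3 / 2) * (Q t) ^ 3)))"
  proof (rule second_derivative_unique(2)[OF g U tU, of ?F ?F1])
    show "symbol \<mu> \<delta> \<nu> (s, 1) = ?F s" if "s \<in> U" for s
      using symbol_profile_rationalized[of \<delta> \<nu> s \<mu>] that assms(1,2)
      by (simp add: U_def Q P_def R_def p_def)
    show "(?F has_real_derivative ?F1 s) (at s)" if "s \<in> U" for s
      using that assms(1) by (intro DERIV_cmult DERIV_add dP(1) dR(1)) (auto simp: U_def)
    show "(?F1 has_real_derivative 2 * \<mu> * \<delta> * ((1 / sqrt \<delta>) * (?N1 / ((1 + \<delta> * t\<^sup>2) powr (3 / 2) * (Q t) ^ 3))
     + \<nu> * (?N2 / ((1 + 1 * t\<^sup>2) powr (3 / 2) * (Q t) ^ 3)))) (at t)"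
      using tU assms(1) by (intro DERIV_cmult DERIV_add dP(2) dR(2)) (auto simp: U_def)
  qed
  have N1: "?N1 / ((1 + \<delta> * t\<^sup>2) powr (3 / 2) * (Q t) ^ 3) = \<delta> * K1 \<delta> \<nu> (1, t)"
  proof -
    have "K1 \<delta> \<nu> (1, t) = (?N1 / \<delta>) / ((1 + \<delta> * t\<^sup>2) powr (3 / 2) * (Q t) ^ 3)"
      unfolding P_def P1_def P2_def Q_def Q1_def Q2_def form12_K1
      unfolding K1_def Let_def p_def[symmetric] b_def[symmetric] c_def[symmetric]
        form12_divide[OF less_imp_neq[OF assms(1), symmetric]] quartic_def by simp
    then show ?thesis using assms(1) by simp
  qed
  have N2: "?N2 / ((1 + 1 * t\<^sup>2) powr (3 / 2) * (Q t) ^ 3) = K2 \<delta> \<nu> (1, t)"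
    unfolding R_def R1_def R2_def Q_def Q1_def Q2_def mult_1 mult_1_right form12_K2
    unfolding K2_def Let_def p_def[symmetric] b_def[symmetric] c_def[symmetric] form12_def quartic_def
    by simp
  have r: "1 / sqrt \<delta> * (\<delta> * k) = sqrt \<delta> * k" for k
  proof -
    have "1 / r * (r * r * k) = r * k" if "r \<noteq> 0" for r :: real using that by simp
    moreover have "sqrt \<delta> \<noteq> 0" "sqrt \<delta> * sqrt \<delta> = \<delta>" using assms(1) by simp_all
    ultimately show ?thesis by metis
  qed
  show ?thesis unfolding g2 N1 N2 r L_kernel_def ..
qed

lemma AE_quartic_nonzero:
  "AE t in lborel. quartic \<delta> \<nu> (1, t) \<noteq> 0"
proof -
  have "quartic \<delta> \<nu> (1, t) = poly [:1, 0, par_b \<delta>, 0, par_c \<delta> \<nu>:] t" for t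
    by (simp add: quartic_def power2_eq_square power4_eq_xxxx algebra_simps)
  then have "finite {t. quartic \<delta> \<nu> (1, t) = 0}"
    by (simp only:) (rule poly_roots_finite, simp)
  then have "{t. quartic \<delta> \<nu> (1, t) = 0} \<in> null_sets lborel" by (rule finite_imp_null_set_lborel)
  from AE_not_in[OF this] show ?thesis by simp
qed

text \<open>The heart of the matter: by \<open>L_kernel_is_second_derivative\<close> the kernel on the line \<open>(1, t)\<close> agrees
almost everywhere with the continuous second derivative of \<open>g\<close>, for which \<open>profile\<close> applies. The
integrability is read off from \<open>g\<close> and not from the formula: for \<open>\<nu> = -1\<close> the terms \<open>K\<^sub>1\<close> and \<open>K\<^sub>2\<close>
grow at infinity, and only their combination decays.\<close>

lemma
  assumes "0 < \<delta>" "\<nu> < 1"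
  shows integrable_L_kernel_slopes: "integrable lborel (\<lambda>t. (1 + \<bar>t\<bar>) * L_kernel \<mu> \<delta> \<nu> (1, t))"
    and symbol_eq_slope_integral:
      "symbol \<mu> \<delta> \<nu> k = 1 / 2 * (\<integral>t. \<bar>fst k + snd k * t\<bar> * L_kernel \<mu> \<delta> \<nu> (1, t) \<partial>lborel)"
proof -
  let ?m = "symbol \<mu> \<delta> \<nu>" and ?K = "L_kernel \<mu> \<delta> \<nu>"
  have even: "?m (- x, y) = ?m (x, y)" "?m (x, - y) = ?m (x, y)" for x y by (simp_all add: symbol_def)
  obtain g1 g2 where g: "C2 (\<lambda>t. ?m (t, 1)) g1 g2"
    using twice_cont_diff_symbol[OF assms twice_cont_diff_intros(2,1), of 1 \<mu>]
    unfolding twice_cont_diff_def by auto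
  obtain h1 h2 where h: "C2 (\<lambda>t. ?m (1, t)) h1 h2"
    using twice_cont_diff_symbol[OF assms twice_cont_diff_intros(1,2), of 1 \<mu>]
    unfolding twice_cont_diff_def by auto
  interpret profile "\<lambda>t. ?m (t, 1)" g1 g2 "\<lambda>t. ?m (1, t)" h1 h2
  proof
    show "?m (t, 1) = t * ?m (1, 1 / t)" if "t > 0" for t
      using symbol_homogeneous[of t \<mu> \<delta> \<nu> 1 "1 / t"] that by simp
  qed (rule g h even)+
  have [measurable]: "?K \<in> borel_measurable borel"
    using homogeneous_kernel_L_kernel[OF assms(1)] by (simp add: homogeneous_kernel_def)
  have [measurable]: "g2 \<in> borel_measurable borel"
    using C2D(3)[OF g] by (auto intro: borel_measurable_continuous_onI continuous_at_imp_continuous_on)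
  have ae: "AE t in lborel. f t * g2 t = f t * ?K (1, t)" for f :: "real \<Rightarrow> real"
    using AE_quartic_nonzero[of \<delta> \<nu>]
    by eventually_elim (simp add: L_kernel_is_second_derivative[OF assms _ g])
  show "integrable lborel (\<lambda>t. (1 + \<bar>t\<bar>) * ?K (1, t))"
    using integrable_g2 by (rule Bochner_Integration.integrable_cong_AE[THEN iffD1, rotated 3]) (measurable, rule ae)
  have "(\<integral>t. \<bar>fst k + snd k * t\<bar> * ?K (1, t) \<partial>lborel) = (\<integral>t. \<bar>fst k + snd k * t\<bar> * g2 t \<partial>lborel)"
    by (intro integral_cong_AE) (measurable, use ae[of "\<lambda>t. \<bar>fst k + snd k * t\<bar>"] in \<open>auto elim!: eventually_mono\<close>)
  also have "\<dots> = 2 * ?m k"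
  proof (cases "snd k = 0")
    case True
    have "?m k = \<bar>fst k\<bar> * ?m (1, 0)"
      using symbol_homogeneous[of "fst k" \<mu> \<delta> \<nu> 1 0] True
      by (cases "fst k = 0"; cases k) (auto simp: symbol_def)
    then show ?thesis using True by (simp add: g2_total)
  next
    case False
    have "\<bar>fst k + snd k * t\<bar> * g2 t = \<bar>snd k\<bar> * (\<bar>t - (- (fst k / snd k))\<bar> * g2 t)" for t
    proof -
      have "fst k + snd k * t = snd k * (t - (- (fst k / snd k)))"
        using False by (simp add: distrib_left)
      then show ?thesis by (simp only: abs_mult mult.assoc)
    qed
    then have "(\<integral>t. \<bar>fst k + snd k * t\<bar> * g2 t \<partial>lborel)
        = (\<integral>t. \<bar>snd k\<bar> * (\<bar>t - (- (fst k / snd k))\<bar> * g2 t) \<partial>lborel)"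
      by presburger
    also have "\<dots> = 2 * (\<bar>snd k\<bar> * ?m (- (fst k / snd k), 1))"
      using g2_dist[of "- (fst k / snd k)"] by (simp only: integral_mult_right_zero mult.left_commute)
    also have "\<bar>snd k\<bar> * ?m (- (fst k / snd k), 1) = ?m k"
      using symbol_homogeneous[of "snd k" \<mu> \<delta> \<nu> "- (fst k / snd k)" 1] False even(1)[of "fst k" "snd k"]
      by simp
    finally show ?thesis .
  qed
  finally show "?m k = 1 / 2 * (\<integral>t. \<bar>fst k + snd k * t\<bar> * ?K (1, t) \<partial>lborel)" by simp
qed

section \<open>Fourier transforms of Schwartz functions\<close>

lemma integrable_product:
  fixes f g :: "real \<Rightarrow> 'b::{real_normed_field, banach, second_countable_topology}"
  assumes f: "integrable lborel f" and g: "integrable lborel g"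
  shows "integrable lborel (\<lambda>x::real \<times> real. f (fst x) * g (snd x))"
    and "(\<integral>x. f (fst x) * g (snd x) \<partial>lborel) = (\<integral>t. f t \<partial>lborel) * (\<integral>t. g t \<partial>lborel)"
proof -
  have [measurable]: "f \<in> borel_measurable borel" "g \<in> borel_measurable borel"
    using borel_measurable_integrable[OF f] borel_measurable_integrable[OF g] by simp_all
  have 1: "integrable (lborel \<Otimes>\<^sub>M lborel) (\<lambda>x::real \<times> real. f (fst x) * g (snd x))"
  proof (rule lborel_pair.Fubini_integrable)
    show "integrable lborel (\<lambda>x. \<integral>y. norm (f (fst (x, y)) * g (snd (x, y))) \<partial>lborel)"
      using f by (simp add: norm_mult)
    show "AE x in lborel. integrable lborel (\<lambda>y. f (fst (x, y)) * g (snd (x, y)))"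
      using g by simp
  qed measurable
  then show "integrable lborel (\<lambda>x::real \<times> real. f (fst x) * g (snd x))" by (simp add: lborel_prod)
  have "(\<integral>x. f (fst x) * g (snd x) \<partial>(lborel \<Otimes>\<^sub>M lborel)) = (\<integral>s. (\<integral>t. f s * g t \<partial>lborel) \<partial>lborel)"
    using lborel_pair.integral_fst'[OF 1] by simp
  then show "(\<integral>x. f (fst x) * g (snd x) \<partial>lborel) = (\<integral>t. f t \<partial>lborel) * (\<integral>t. g t \<partial>lborel)"
    by (simp add: lborel_prod)
qed

text \<open>The witness in the definition of \<open>schwartz\<close>. Shifting its indices gives again such a family,
so induction over derivatives takes place inside one family.\<close>

definition schwartz_family :: "(nat \<Rightarrow> nat \<Rightarrow> real \<times> real \<Rightarrow> complex) \<Rightarrow> bool" where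
  "schwartz_family D \<longleftrightarrow>
       (\<forall>i j x. (D i j has_derivative
                  (\<lambda>h. fst h *\<^sub>R D (Suc i) j x + snd h *\<^sub>R D i (Suc j) x)) (at x)) \<and>
       (\<forall>i j n. bounded (range (\<lambda>x. norm x ^ n *\<^sub>R D i j x)))"

lemma schwartz_iff_family: "schwartz w \<longleftrightarrow> (\<exists>D. D 0 0 = w \<and> schwartz_family D)"
  by (simp add: schwartz_def schwartz_family_def)

lemma schwartz_family_decay:
  assumes "schwartz_family D"
  shows "\<exists>C. \<forall>x. norm (D i j x) \<le> C * (inverse (1 + (fst x)\<^sup>2) * inverse (1 + (snd x)\<^sup>2))"
proof -
  have "\<exists>B. \<forall>x. norm (norm x ^ n *\<^sub>R D i j x) \<le> B" for n
  proof -
    have "bounded (range (\<lambda>x. norm x ^ n *\<^sub>R D i j x))"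
      using assms unfolding schwartz_family_def by blast
    then show ?thesis unfolding bounded_iff by auto
  qed
  then obtain B where B: "\<And>n x. norm (norm x ^ n *\<^sub>R D i j x) \<le> B n" by metis
  have "norm (D i j x) \<le> (B 0 + 2 * B 2 + B 4) * (inverse (1 + (fst x)\<^sup>2) * inverse (1 + (snd x)\<^sup>2))" for x
  proof -
    have "(1 + (fst x)\<^sup>2) * (1 + (snd x)\<^sup>2) \<le> (1 + (norm x)\<^sup>2) * (1 + (norm x)\<^sup>2)"
      by (intro mult_mono) (auto simp: norm_prod_def)
    then have "(1 + (fst x)\<^sup>2) * (1 + (snd x)\<^sup>2) * norm (D i j x) \<le> (1 + (norm x)\<^sup>2) * (1 + (norm x)\<^sup>2) * norm (D i j x)"
      by (rule mult_right_mono) simp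
    also have "\<dots> = norm (norm x ^ 0 *\<^sub>R D i j x) + 2 * norm (norm x ^ 2 *\<^sub>R D i j x) + norm (norm x ^ 4 *\<^sub>R D i j x)"
      by (simp add: algebra_simps power2_eq_square power4_eq_xxxx)
    also have "\<dots> \<le> B 0 + 2 * B 2 + B 4"
      using B[of x 0] B[of x 2] B[of x 4] by linarith
    finally show ?thesis
      by (simp add: field_simps add_pos_nonneg)
  qed
  then show ?thesis by blast
qed

lemma schwartz_family_continuous: "schwartz_family D \<Longrightarrow> continuous_on X (D i j)"
  unfolding schwartz_family_def by (meson continuous_at_imp_continuous_on has_derivative_continuous)

lemma schwartz_family_measurable: "schwartz_family D \<Longrightarrow> D i j \<in> borel_measurable borel"
  by (intro borel_measurable_continuous_onI schwartz_family_continuous)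

lemma schwartz_family_bounded:
  assumes "schwartz_family D"
  shows "\<exists>C. \<forall>x. norm (D i j x) \<le> C"
proof -
  have "bounded (range (\<lambda>x. norm x ^ 0 *\<^sub>R D i j x))"
    using assms unfolding schwartz_family_def by blast
  then show ?thesis unfolding bounded_iff by auto
qed

lemma schwartz_family_integrable:
  assumes "schwartz_family D"
  shows "integrable lborel (D i j)"
proof -
  obtain C where C: "\<And>x. norm (D i j x) \<le> C * (inverse (1 + (fst x)\<^sup>2) * inverse (1 + (snd x)\<^sup>2))"
    using schwartz_family_decay[OF assms] by blast
  have "integrable lborel (\<lambda>x::real \<times> real. C * (inverse (1 + (fst x)\<^sup>2) * inverse (1 + (snd x)\<^sup>2)))"
    using integrable_product(1)[OF integrable_inverse_square integrable_inverse_square] by simp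
  then show ?thesis
    by (rule Bochner_Integration.integrable_bound)
       (use schwartz_family_measurable[OF assms] C in \<open>auto intro!: AE_I2 order_trans[OF C abs_ge_self]\<close>)
qed

lemma integral_derivative_zero:
  fixes F f :: "real \<Rightarrow> complex"
  assumes "\<And>t. (F has_vector_derivative f t) (at t)" "\<And>t. isCont f t" "integrable lborel f"
    and "(F \<longlongrightarrow> 0) at_top" "(F \<longlongrightarrow> 0) at_bot"
  shows "(\<integral>t. f t \<partial>lborel) = 0"
proof -
  have "(LBINT t=-\<infinity>..\<infinity>. f t) = 0 - 0"
    by (rule interval_integral_FTC_integrable[where F=F])
       (use assms in \<open>auto simp: ereal_tendsto_simps set_integrable_def\<close>)
  then show ?thesis by (simp add: interval_lebesgue_integral_def set_lebesgue_integral_def)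
qed

lemma swap_pair_integral:
  fixes f :: "real \<times> real \<Rightarrow> 'b::{banach, second_countable_topology}"
  assumes [measurable]: "f \<in> borel_measurable borel"
  shows "(\<integral>x. f (snd x, fst x) \<partial>lborel) = (\<integral>x. f x \<partial>lborel)"
proof -
  have [measurable]: "f \<in> borel_measurable (lborel \<Otimes>\<^sub>M lborel)" by (simp add: lborel_prod)
  show "(\<integral>x. f (snd x, fst x) \<partial>lborel) = (\<integral>x. f x \<partial>lborel)"
    using lborel_pair.integral_product_swap[of f] by (simp add: lborel_prod case_prod_unfold)
qed

lemma tendsto_zero_inverse_square_bound:
  fixes F :: "real \<Rightarrow> complex"
  assumes "\<And>t. norm (F t) \<le> C * inverse (1 + t\<^sup>2)"
  shows "(F \<longlongrightarrow> 0) at_top" "(F \<longlongrightarrow> 0) at_bot"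
proof -
  have l: "((\<lambda>t::real. inverse (1 + t\<^sup>2)) \<longlongrightarrow> 0) at_top" "((\<lambda>t::real. inverse (1 + t\<^sup>2)) \<longlongrightarrow> 0) at_bot"
    by real_asymp+
  show "(F \<longlongrightarrow> 0) at_top" "(F \<longlongrightarrow> 0) at_bot"
    by (rule Lim_null_comparison[OF always_eventually[OF allI[OF assms]]
          tendsto_mult_right_zero[OF l(1), of C]],
        rule Lim_null_comparison[OF always_eventually[OF allI[OF assms]]
          tendsto_mult_right_zero[OF l(2), of C]])
qed

lemma fourier_integrable:
  assumes "integrable lborel f"
  shows "integrable lborel (\<lambda>x. exp (- (\<i> * of_real (x \<bullet> k))) * f x)"
proof (rule Bochner_Integration.integrable_bound[OF assms])
  have [measurable]: "f \<in> borel_measurable borel" using borel_measurable_integrable[OF assms] by simp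
  show "(\<lambda>x. exp (- (\<i> * of_real (x \<bullet> k))) * f x) \<in> borel_measurable lborel" by measurable
  show "AE x in lborel. norm (exp (- (\<i> * of_real (x \<bullet> k))) * f x) \<le> norm (f x)"
    by (intro AE_I2) (simp add: norm_mult)
qed

text \<open>Integration by parts in the first variable: for each \<open>t\<close> the
integrand below is the derivative of \<open>exp (- \<i> (x \<bullet> k)) u\<close> along the line of height \<open>t\<close> and has
integral zero. The second variable is reduced to this case by exchanging coordinates.\<close>

lemma fourier_derivative_fst:
  fixes u u' :: "real \<times> real \<Rightarrow> complex"
  assumes der: "\<And>s t. ((\<lambda>s. u (s, t)) has_vector_derivative u' (s, t)) (at s)"
    and c: "continuous_on UNIV u'"
    and int: "integrable lborel u" "integrable lborel u'"
    and decay: "\<And>x. norm (u x) \<le> C * (inverse (1 + (fst x)\<^sup>2) * inverse (1 + (snd x)\<^sup>2))"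
       "\<And>x. norm (u' x) \<le> C' * (inverse (1 + (fst x)\<^sup>2) * inverse (1 + (snd x)\<^sup>2))"
  shows "fourier u' k = \<i> * of_real (fst k) * fourier u k"
proof -
  let ?e = "\<lambda>x. exp (- (\<i> * of_real (x \<bullet> k)))"
  have [measurable]: "u \<in> borel_measurable borel" "u' \<in> borel_measurable borel"
    using borel_measurable_integrable[OF int(1)] borel_measurable_integrable[OF int(2)] by simp_all
  let ?f = "\<lambda>x. ?e x * u' x - \<i> * of_real (fst k) * (?e x * u x)"
  have i: "integrable lborel ?f"
    using fourier_integrable[OF int(1)] fourier_integrable[OF int(2)] by simp
  then have i': "integrable (lborel \<Otimes>\<^sub>M lborel) ?f" by (simp add: lborel_prod)
  have "(\<integral>s. ?f (s, t) \<partial>lborel) = 0" for t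
  proof (rule integral_derivative_zero[where F="\<lambda>s. ?e (s, t) * u (s, t)"])
    have "((\<lambda>s. ?e (s, t)) has_vector_derivative (- (\<i> * of_real (fst k)) * ?e (s, t))) (at s)" for s
    proof -
      have "((\<lambda>z. exp (- (\<i> * (z * of_real (fst k) + of_real (t * snd k))))) has_field_derivative
          (- (\<i> * of_real (fst k)) * exp (- (\<i> * (of_real s * of_real (fst k) + of_real (t * snd k))))))
          (at (of_real s))"
        by (auto intro!: derivative_eq_intros)
      from has_vector_derivative_real_field[OF this] show ?thesis
        by (simp add: inner_prod_def)
    qed
    from has_vector_derivative_mult[OF this der]
    show "((\<lambda>s. ?e (s, t) * u (s, t)) has_vector_derivative ?f (s, t)) (at s)" for s
      by (rule has_vector_derivative_eq_rhs) (simp add: algebra_simps)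
    have cu: "isCont (\<lambda>s. u (s, t)) s" for s
      using der by (rule has_vector_derivative_continuous)
    have cu': "isCont (\<lambda>s. u' (s, t)) s" for s
    proof -
      have "continuous_on UNIV (\<lambda>s. u' (s, t))"
        by (rule continuous_on_compose2[OF c]) (auto intro!: continuous_intros)
      then show ?thesis by (simp add: continuous_on_eq_continuous_at)
    qed
    show "isCont (\<lambda>s. ?f (s, t)) s" for s by (intro continuous_intros cu cu')
    have b: "inverse (1 + t\<^sup>2) \<le> 1" for t :: real by (simp add: inverse_le_1_iff)
    have C: "C \<ge> 0" "C' \<ge> 0" using order_trans[OF norm_ge_zero decay(1)[of 0]] order_trans[OF norm_ge_zero decay(2)[of 0]]
      by simp_all
    have d: "norm (u (s, t)) \<le> C * inverse (1 + s\<^sup>2)" "norm (u' (s, t)) \<le> C' * inverse (1 + s\<^sup>2)" for s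
    proof -
      have "inverse (1 + s\<^sup>2) * inverse (1 + t\<^sup>2) \<le> inverse (1 + s\<^sup>2) * 1"
        by (intro mult_left_mono b) auto
      then have "C * (inverse (1 + s\<^sup>2) * inverse (1 + t\<^sup>2)) \<le> C * inverse (1 + s\<^sup>2)"
        "C' * (inverse (1 + s\<^sup>2) * inverse (1 + t\<^sup>2)) \<le> C' * inverse (1 + s\<^sup>2)"
        using C by (auto intro!: mult_left_mono)
      then show "norm (u (s, t)) \<le> C * inverse (1 + s\<^sup>2)" "norm (u' (s, t)) \<le> C' * inverse (1 + s\<^sup>2)"
        using decay(1)[of "(s, t)"] decay(2)[of "(s, t)"] by auto
    qed
    show "((\<lambda>s. ?e (s, t) * u (s, t)) \<longlongrightarrow> 0) at_top" "((\<lambda>s. ?e (s, t) * u (s, t)) \<longlongrightarrow> 0) at_bot"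
      using d(1) by (auto intro!: tendsto_zero_inverse_square_bound[of _ C] simp: norm_mult)
    show "integrable lborel (\<lambda>s. ?f (s, t))"
    proof (rule Bochner_Integration.integrable_bound)
      show "integrable lborel (\<lambda>s::real. (C' + \<bar>fst k\<bar> * C) * inverse (1 + s\<^sup>2))"
        using integrable_inverse_square by simp
      show "(\<lambda>s. ?f (s, t)) \<in> borel_measurable lborel" by measurable
      have "norm (?f (s, t)) \<le> (C' + \<bar>fst k\<bar> * C) * inverse (1 + s\<^sup>2)" for s
      proof -
        have "norm (?f (s, t)) \<le> norm (u' (s, t)) + \<bar>fst k\<bar> * norm (u (s, t))"
          by (rule order_trans[OF norm_triangle_ineq4]) (simp add: norm_mult)
        also have "\<dots> \<le> C' * inverse (1 + s\<^sup>2) + \<bar>fst k\<bar> * (C * inverse (1 + s\<^sup>2))"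
          by (intro add_mono mult_left_mono d) auto
        finally show ?thesis by (simp add: algebra_simps)
      qed
      then show "AE s in lborel. norm (?f (s, t)) \<le> norm ((C' + \<bar>fst k\<bar> * C) * inverse (1 + s\<^sup>2))"
        by (intro AE_I2) (auto intro: order_trans[OF _ abs_ge_self])
    qed
  qed
  then have "(\<integral>x. ?f x \<partial>lborel) = 0"
    using lborel_pair.integral_snd[of "\<lambda>s t. ?f (s, t)"] i' by (simp add: lborel_prod case_prod_unfold)
  then show ?thesis
    using fourier_integrable[OF int(1), of k] fourier_integrable[OF int(2), of k] by (simp add: fourier_def)
qed

lemma fourier_swap:
  assumes [measurable]: "u \<in> borel_measurable borel"
  shows "fourier (\<lambda>x. u (snd x, fst x)) k = fourier u (snd k, fst k)"
  unfolding fourier_def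
  by (subst swap_pair_integral[symmetric]) (measurable, simp add: inner_prod_def add.commute)

lemma schwartz_family_swap:
  assumes "schwartz_family D"
  shows "schwartz_family (\<lambda>i j x. D j i (snd x, fst x))"
proof -
  have n: "norm (snd x, fst x) = norm x" for x :: "real \<times> real"
    by (cases x) (simp add: norm_prod_def add.commute)
  have "((\<lambda>x. D j i (snd x, fst x)) has_derivative
         (\<lambda>h. fst h *\<^sub>R D j (Suc i) (snd x, fst x) + snd h *\<^sub>R D (Suc j) i (snd x, fst x))) (at x)" for i j x
  proof -
    have "((\<lambda>x::real \<times> real. (snd x, fst x)) has_derivative (\<lambda>h. (snd h, fst h))) (at x)"
      by (auto intro!: derivative_eq_intros)
    moreover have "(D j i has_derivative
         (\<lambda>h. fst h *\<^sub>R D (Suc j) i (snd x, fst x) + snd h *\<^sub>R D j (Suc i) (snd x, fst x))) (at (snd x, fst x))"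
      using assms unfolding schwartz_family_def by blast
    ultimately show ?thesis
      by (rule has_derivative_compose[THEN has_derivative_eq_rhs]) (auto simp: add.commute)
  qed
  moreover have "bounded (range (\<lambda>x. norm x ^ n *\<^sub>R D j i (snd x, fst x)))" for i j n
  proof -
    have "bounded (range (\<lambda>x. norm x ^ n *\<^sub>R D j i x))"
      using assms unfolding schwartz_family_def by blast
    then obtain B where B: "\<And>x. norm (norm x ^ n *\<^sub>R D j i x) \<le> B"
      unfolding bounded_iff by auto
    have "norm (norm x ^ n *\<^sub>R D j i (snd x, fst x)) \<le> B" for x
      using B[of "(snd x, fst x)"] by (simp add: n[of x])
    then show ?thesis unfolding bounded_iff by blast
  qed
  ultimately show ?thesis unfolding schwartz_family_def by blast
qed

lemma schwartz_family_fourier_fst: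
  assumes D: "schwartz_family D"
  shows "fourier (D (Suc i) j) k = \<i> * of_real (fst k) * fourier (D i j) k"
proof -
  obtain C where C: "\<And>x. norm (D i j x) \<le> C * (inverse (1 + (fst x)\<^sup>2) * inverse (1 + (snd x)\<^sup>2))"
    using schwartz_family_decay[OF D] by blast
  obtain C' where C': "\<And>x. norm (D (Suc i) j x) \<le> C' * (inverse (1 + (fst x)\<^sup>2) * inverse (1 + (snd x)\<^sup>2))"
    using schwartz_family_decay[OF D] by blast
  show ?thesis
  proof (rule fourier_derivative_fst[OF _ schwartz_family_continuous[OF D]
        schwartz_family_integrable[OF D] schwartz_family_integrable[OF D] C C'])
    fix s t :: real
    have "((\<lambda>s. (s, t)) has_derivative (\<lambda>h. (h, 0))) (at s)"
      by (auto intro!: derivative_eq_intros)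
    moreover have "(D i j has_derivative
         (\<lambda>h. fst h *\<^sub>R D (Suc i) j (s, t) + snd h *\<^sub>R D i (Suc j) (s, t))) (at (s, t))"
      using D unfolding schwartz_family_def by blast
    ultimately show "((\<lambda>s. D i j (s, t)) has_vector_derivative D (Suc i) j (s, t)) (at s)"
      unfolding has_vector_derivative_def
      by (rule has_derivative_compose[THEN has_derivative_eq_rhs]) auto
  qed
qed

lemma schwartz_family_fourier_snd:
  assumes D: "schwartz_family D"
  shows "fourier (D i (Suc j)) k = \<i> * of_real (snd k) * fourier (D i j) k"
proof -
  have *: "fourier (D i j) k = fourier (\<lambda>x. D i j (snd x, fst x)) (snd k, fst k)" for i j
    using fourier_swap[OF schwartz_family_measurable[OF D], of i j "(snd k, fst k)"] by simp
  show ?thesis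
    unfolding * using schwartz_family_fourier_fst[OF schwartz_family_swap[OF D], where i=j and j=i and k="(snd k, fst k)"] by simp
qed

lemma schwartz_family_fourier:
  assumes D: "schwartz_family D"
  shows "fourier (D i j) k = (\<i> * of_real (fst k)) ^ i * (\<i> * of_real (snd k)) ^ j * fourier (D 0 0) k"
proof -
  have "fourier (D i 0) k = (\<i> * of_real (fst k)) ^ i * fourier (D 0 0) k"
    by (induction i) (simp_all add: schwartz_family_fourier_fst[OF D])
  moreover have "fourier (D i j) k = (\<i> * of_real (snd k)) ^ j * fourier (D i 0) k"
    by (induction j) (simp_all add: schwartz_family_fourier_snd[OF D])
  ultimately show ?thesis by simp
qed

lemma fourier_measurable [measurable]:
  assumes [measurable]: "w \<in> borel_measurable borel"
  shows "fourier w \<in> borel_measurable borel"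
proof -
  have "(\<lambda>k. LINT x|lborel. exp (- (\<i> * of_real (x \<bullet> k))) * w x) \<in> borel_measurable borel"
    by (rule lborel.borel_measurable_lebesgue_integral) measurable
  then show ?thesis by (simp add: fourier_def[abs_def])
qed

lemma fourier_norm_le: "norm (fourier w k) \<le> (\<integral>x. norm (w x) \<partial>lborel)"
  unfolding fourier_def by (rule order_trans[OF integral_norm_bound]) (simp add: norm_mult)

text \<open>Each monomial times the transform is bounded by the integral of a derivative. The factor
\<open>1 + norm k\<close> is at most \<open>(1 + \<bar>k\<^sub>1\<bar>) (1 + \<bar>k\<^sub>3\<bar>)\<close>, and together with the two quadratic weights this is
a polynomial of degree three in each variable, all of whose coefficients are one.\<close>

lemma schwartz_fourier_decay:
  assumes "schwartz w"
  shows "\<exists>C. \<forall>k. (1 + norm k) * norm (fourier w k) \<le> C * (inverse (1 + (fst k)\<^sup>2) * inverse (1 + (snd k)\<^sup>2))"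
proof -
  obtain D where "D 0 0 = w" and D: "schwartz_family D"
    using assms unfolding schwartz_iff_family by (elim exE conjE that)
  then have w: "w = D 0 0" by simp
  define N where "N = (\<lambda>i j. \<integral>x. norm (D i j x) \<partial>lborel)"
  have N: "\<bar>fst k\<bar> ^ i * \<bar>snd k\<bar> ^ j * norm (fourier w k) \<le> N i j" for i j k
    using fourier_norm_le[of "D i j" k]
    by (subst (asm) schwartz_family_fourier[OF D]) (simp add: N_def w norm_mult norm_power)
  let ?C = "\<Sum>i\<le>3. \<Sum>j\<le>3. N i j"
  have "(1 + norm k) * norm (fourier w k) \<le> ?C * (inverse (1 + (fst k)\<^sup>2) * inverse (1 + (snd k)\<^sup>2))" for k
  proof -
    define a b where "a = \<bar>fst k\<bar>" and "b = \<bar>snd k\<bar>"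
    have ab: "a \<ge> 0" "b \<ge> 0" by (simp_all add: a_def b_def)
    have sq: "(fst k)\<^sup>2 = a\<^sup>2" "(snd k)\<^sup>2 = b\<^sup>2" by (simp_all add: a_def b_def)
    have "norm k \<le> a + b" using norm_prod_def[of k] sqrt_sum_squares_le_sum_abs[of "fst k" "snd k"]
      by (simp add: a_def b_def)
    then have "1 + norm k \<le> (1 + a) * (1 + b)"
    proof -
      have "(1 + a) * (1 + b) = 1 + a + b + a * b" by algebra
      with \<open>norm k \<le> a + b\<close> mult_nonneg_nonneg[OF ab] show ?thesis by linarith
    qed
    then have "(1 + norm k) * ((1 + a\<^sup>2) * (1 + b\<^sup>2)) \<le> ((1 + a) * (1 + b)) * ((1 + a\<^sup>2) * (1 + b\<^sup>2))"
      by (rule mult_right_mono) simp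
    also have "\<dots> = (\<Sum>i\<le>3. a ^ i) * (\<Sum>j\<le>3. b ^ j)"
      by (simp add: eval_nat_numeral algebra_simps)
    also have "\<dots> = (\<Sum>i\<le>3. \<Sum>j\<le>3. a ^ i * b ^ j)" by (simp add: sum_product)
    finally have "(1 + norm k) * ((1 + a\<^sup>2) * (1 + b\<^sup>2)) * norm (fourier w k)
      \<le> (\<Sum>i\<le>3. \<Sum>j\<le>3. a ^ i * b ^ j) * norm (fourier w k)"
      by (rule mult_right_mono) simp
    also have "\<dots> \<le> ?C"
      unfolding sum_distrib_right a_def b_def by (intro sum_mono N)
    finally show ?thesis
      unfolding sq by (simp add: field_simps add_pos_nonneg)
  qed
  then show ?thesis by blast
qed

lemma schwartz_fourier_integrable:
  assumes "schwartz w"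
  shows "integrable lborel (\<lambda>k. (1 + norm k) * norm (fourier w k))"
proof -
  obtain D where "D 0 0 = w" and D: "schwartz_family D"
    using assms unfolding schwartz_iff_family by (elim exE conjE that)
  then have w: "w = D 0 0" by simp
  have [measurable]: "w \<in> borel_measurable borel" using schwartz_family_measurable[OF D] w by simp
  obtain C where C: "\<And>k. (1 + norm k) * norm (fourier w k) \<le> C * (inverse (1 + (fst k)\<^sup>2) * inverse (1 + (snd k)\<^sup>2))"
    using schwartz_fourier_decay[OF assms] by blast
  have "integrable lborel (\<lambda>x::real \<times> real. C * (inverse (1 + (fst x)\<^sup>2) * inverse (1 + (snd x)\<^sup>2)))"
    using integrable_product(1)[OF integrable_inverse_square integrable_inverse_square] by simp
  then show ?thesis
    by (rule Bochner_Integration.integrable_bound)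
       (measurable, intro AE_I2, use order_trans[OF C abs_ge_self] in \<open>simp add: abs_mult\<close>)
qed

section \<open>Fourier inversion\<close>

lemma integral_scale_plane:
  fixes f :: "real \<times> real \<Rightarrow> complex"
  assumes [measurable]: "f \<in> borel_measurable borel" and c: "c \<noteq> 0"
  shows "(\<integral>x. f x \<partial>lborel) = c\<^sup>2 *\<^sub>R (\<integral>x. f (t + c *\<^sub>R x) \<partial>lborel)"
  using c by (subst lborel_affine[of c t]) (simp_all add: integral_density integral_distr power2_eq_square)

lemma integrable_scale_plane:
  fixes f :: "real \<times> real \<Rightarrow> complex"
  assumes f: "integrable lborel f" and c: "c \<noteq> 0"
  shows "integrable lborel (\<lambda>x. f (t + c *\<^sub>R x))"
proof -
  have [measurable]: "f \<in> borel_measurable borel" using f by (auto dest: borel_measurable_integrable)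
  have "integrable (density (distr lborel borel (\<lambda>x. t + c *\<^sub>R x)) (\<lambda>_. \<bar>c\<bar> ^ DIM(real \<times> real))) f"
    using f lborel_affine[of c t] c by simp
  then have "integrable lborel (\<lambda>x. (c * c) *\<^sub>R f (t + c *\<^sub>R x))"
    by (simp add: integrable_density integrable_distr_eq)
  from integrable_scaleR_right[OF this, of "inverse (c * c)"]
  have "integrable lborel (\<lambda>x. (inverse (c * c) * (c * c)) *\<^sub>R f (t + c *\<^sub>R x))"
    by (simp only: scaleR_scaleR)
  moreover have "inverse (c * c) * (c * c) = 1" using c by (intro left_inverse) simp
  ultimately show ?thesis by (simp only: scaleR_one)
qed

text \<open>Normalized by \<open>gauss 0 = 1\<close> and not as a density, so that it is bounded by one and serves as a
cutoff on the Fourier side.\<close>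

definition gauss :: "real \<times> real \<Rightarrow> real" where
  "gauss x = exp (- (norm x)\<^sup>2 / 2)"

lemma gauss_split: "gauss x = 2 * pi * (std_normal_density (fst x) * std_normal_density (snd x))"
proof -
  have "sqrt (2 * pi) * sqrt (2 * pi) = 2 * pi" by simp
  then show ?thesis
    by (simp add: gauss_def std_normal_density_def norm_prod_def mult_exp_exp field_simps)
qed

lemma gauss_simps: "gauss x \<ge> 0" "gauss x \<le> 1" "gauss (- x) = gauss x"
  by (simp_all add: gauss_def)

lemma continuous_on_gauss [continuous_intros]: "continuous_on X f \<Longrightarrow> continuous_on X (\<lambda>x. gauss (f x))"
  unfolding gauss_def by (intro continuous_intros) auto

lemma gauss_measurable [measurable]: "gauss \<in> borel_measurable borel"
  by (intro borel_measurable_continuous_onI continuous_intros)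

lemma fourier_std_normal:
  "integrable lborel (\<lambda>s. exp (\<i> * of_real (u * s)) * complex_of_real (std_normal_density s))"
  "(\<integral>s. exp (\<i> * of_real (u * s)) * complex_of_real (std_normal_density s) \<partial>lborel) = of_real (exp (- u\<^sup>2 / 2))"
proof -
  have n: "integrable lborel std_normal_density"
    using integrable_std_normal_moment[of 0] by simp
  show "integrable lborel (\<lambda>s. exp (\<i> * of_real (u * s)) * complex_of_real (std_normal_density s))"
    by (rule Bochner_Integration.integrable_bound[OF n])
       (auto simp: norm_mult)
  have "(\<integral>s. exp (\<i> * of_real (u * s)) * complex_of_real (std_normal_density s) \<partial>lborel)
      = char std_normal_distribution u"
    unfolding char_def
    by (subst integral_density) (auto simp: scaleR_conv_of_real mult.commute normal_density_nonneg)
  then show "(\<integral>s. exp (\<i> * of_real (u * s)) * complex_of_real (std_normal_density s) \<partial>lborel)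
     = of_real (exp (- u\<^sup>2 / 2))" by (simp add: char_std_normal_distribution)
qed

lemma gauss_fourier:
  shows "integrable lborel (\<lambda>k. exp (\<i> * of_real (u \<bullet> k)) * complex_of_real (gauss k))"
    and "(\<integral>k. exp (\<i> * of_real (u \<bullet> k)) * complex_of_real (gauss k) \<partial>lborel) = of_real (2 * pi * gauss u)"
proof -
  have split: "exp (\<i> * of_real (u \<bullet> k)) * complex_of_real (gauss k)
     = of_real (2 * pi) * (exp (\<i> * of_real (fst u * fst k)) * of_real (std_normal_density (fst k))
         * (exp (\<i> * of_real (snd u * snd k)) * of_real (std_normal_density (snd k))))" for k
    by (simp add: gauss_split inner_prod_def distrib_left exp_add)
  note p = integrable_product[OF fourier_std_normal(1)[of "fst u"] fourier_std_normal(1)[of "snd u"]]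
  show "integrable lborel (\<lambda>k. exp (\<i> * of_real (u \<bullet> k)) * complex_of_real (gauss k))"
    unfolding split using p(1) by (rule integrable_mult_right)
  have "(\<integral>k. exp (\<i> * of_real (u \<bullet> k)) * complex_of_real (gauss k) \<partial>lborel)
     = of_real (2 * pi) * (of_real (exp (- (fst u)\<^sup>2 / 2)) * of_real (exp (- (snd u)\<^sup>2 / 2)))"
    unfolding split by (simp only: integral_mult_right_zero p(2) fourier_std_normal(2))
  also have "\<dots> = of_real (2 * pi * gauss u)"
  proof -
    have "exp (- (fst u)\<^sup>2 / 2) * exp (- (snd u)\<^sup>2 / 2) = gauss u"
      by (simp add: gauss_def norm_prod_def mult_exp_exp field_simps)
    then show ?thesis by (simp only: of_real_mult[symmetric])
  qed
  finally show "(\<integral>k. exp (\<i> * of_real (u \<bullet> k)) * complex_of_real (gauss k) \<partial>lborel) = of_real (2 * pi * gauss u)" .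
qed

lemma gauss_integral:
  "integrable lborel gauss" "(\<integral>x. complex_of_real (gauss x) \<partial>lborel) = of_real (2 * pi)"
proof -
  have "integrable lborel (\<lambda>k. complex_of_real (gauss k))" using gauss_fourier(1)[of 0] by simp
  from integrable_norm[OF this] show "integrable lborel gauss" by (simp add: gauss_simps)
  show "(\<integral>x. complex_of_real (gauss x) \<partial>lborel) = of_real (2 * pi)"
    using gauss_fourier(2)[of 0] by (simp add: gauss_def)
qed

lemma gauss_fourier_scaled:
  assumes e: "e > 0"
  shows "integrable lborel (\<lambda>k. exp (\<i> * of_real (u \<bullet> k)) * complex_of_real (gauss (e *\<^sub>R k)))"
    and "(\<integral>k. exp (\<i> * of_real (u \<bullet> k)) * complex_of_real (gauss (e *\<^sub>R k)) \<partial>lborel)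
      = of_real (2 * pi / e\<^sup>2 * gauss (u /\<^sub>R e))"
proof -
  have r: "exp (\<i> * of_real ((u /\<^sub>R e) \<bullet> (0 + e *\<^sub>R k))) * complex_of_real (gauss (0 + e *\<^sub>R k))
    = exp (\<i> * of_real (u \<bullet> k)) * complex_of_real (gauss (e *\<^sub>R k))" for k
  proof -
    have "(u /\<^sub>R e) \<bullet> (0 + e *\<^sub>R k) = u \<bullet> k" using e by simp
    then show ?thesis by (simp only: add_0)
  qed
  have "integrable lborel (\<lambda>k. exp (\<i> * of_real ((u /\<^sub>R e) \<bullet> (0 + e *\<^sub>R k))) * complex_of_real (gauss (0 + e *\<^sub>R k)))"
    using e by (intro integrable_scale_plane gauss_fourier(1)) simp
  then show "integrable lborel (\<lambda>k. exp (\<i> * of_real (u \<bullet> k)) * complex_of_real (gauss (e *\<^sub>R k)))"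
    unfolding r .
  have "of_real (2 * pi * gauss (u /\<^sub>R e)) = e\<^sup>2 *\<^sub>R
     (\<integral>k. exp (\<i> * of_real ((u /\<^sub>R e) \<bullet> (0 + e *\<^sub>R k))) * complex_of_real (gauss (0 + e *\<^sub>R k)) \<partial>lborel)"
    unfolding gauss_fourier(2)[symmetric] using e by (intro integral_scale_plane) auto
  then show "(\<integral>k. exp (\<i> * of_real (u \<bullet> k)) * complex_of_real (gauss (e *\<^sub>R k)) \<partial>lborel)
      = of_real (2 * pi / e\<^sup>2 * gauss (u /\<^sub>R e))"
    unfolding r using e by (simp add: scaleR_conv_of_real field_simps)
qed

text \<open>Moving the transform from one factor to the other is the theorem of Fubini. With a Gaussian as
second factor it yields inversion up to a mollification.\<close>

lemma fourier_multiplication: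
  assumes f: "integrable lborel f" and g: "integrable lborel g"
  shows "(\<integral>k. fourier f k * g k \<partial>lborel) = (\<integral>x. f x * fourier g x \<partial>lborel)"
proof -
  have [measurable]: "f \<in> borel_measurable borel" "g \<in> borel_measurable borel"
    using f g by (auto dest: borel_measurable_integrable)
  let ?h = "\<lambda>(x, k). exp (- (\<i> * of_real (x \<bullet> k))) * f x * g k"
  have "integrable (lborel \<Otimes>\<^sub>M lborel) ?h"
  proof (rule lborel_pair.Fubini_integrable)
    show "?h \<in> borel_measurable (lborel \<Otimes>\<^sub>M lborel)" by measurable
    have "(\<lambda>x. \<integral>y. norm (?h (x, y)) \<partial>lborel) = (\<lambda>x. norm (f x) * (\<integral>y. norm (g y) \<partial>lborel))"
      by (simp add: norm_mult)
    then show "integrable lborel (\<lambda>x. \<integral>y. norm (?h (x, y)) \<partial>lborel)" using f by simp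
    show "AE x in lborel. integrable lborel (\<lambda>y. ?h (x, y))"
    proof (rule AE_I2)
      fix x
      have "integrable lborel (\<lambda>y. f x * (exp (- (\<i> * of_real (y \<bullet> x))) * g y))"
        using fourier_integrable[OF g, of x] by simp
      then show "integrable lborel (\<lambda>y. ?h (x, y))" by (simp add: ac_simps inner_commute)
    qed
  qed
  then have swap: "(\<integral>k. (\<integral>x. ?h (x, k) \<partial>lborel) \<partial>lborel) = (\<integral>x. (\<integral>k. ?h (x, k) \<partial>lborel) \<partial>lborel)"
    using lborel_pair.Fubini_integral[of "\<lambda>x k. ?h (x, k)"] by simp
  have x: "(\<integral>x. ?h (x, k) \<partial>lborel) = fourier f k * g k" for k
    by (simp add: fourier_def)
  have k: "(\<integral>k. ?h (x, k) \<partial>lborel) = f x * fourier g x" for x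
  proof -
    have "?h (x, k) = f x * (exp (- (\<i> * of_real (k \<bullet> x))) * g k)" for k
      by (simp add: inner_commute[of k x])
    then show ?thesis by (simp only: integral_mult_right_zero fourier_def)
  qed
  show ?thesis using swap unfolding x k .
qed

text \<open>The cutoff \<open>gauss (e k)\<close> on the Fourier side is convolution with a Gaussian of width \<open>e\<close>; after
rescaling, the width only enters as the argument of \<open>w\<close>, so that \<open>e \<longlonglongrightarrow> 0\<close> is dominated convergence.\<close>

lemma gaussian_regularized_inversion:
  assumes w: "integrable lborel w" and e: "e > 0"
  shows "(\<integral>k. fourier w k * (exp (\<i> * of_real (x \<bullet> k)) * of_real (gauss (e *\<^sub>R k))) \<partial>lborel)
       = of_real (2 * pi) * (\<integral>z. w (x + e *\<^sub>R z) * of_real (gauss z) \<partial>lborel)"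
proof -
  have [measurable]: "w \<in> borel_measurable borel" using w by (auto dest: borel_measurable_integrable)
  let ?g = "\<lambda>k. exp (\<i> * of_real (x \<bullet> k)) * complex_of_real (gauss (e *\<^sub>R k))"
  have g: "fourier ?g y = of_real (2 * pi / e\<^sup>2 * gauss ((y - x) /\<^sub>R e))" for y
  proof -
    have "exp (- (\<i> * of_real (k \<bullet> y))) * ?g k = exp (\<i> * of_real ((x - y) \<bullet> k)) * complex_of_real (gauss (e *\<^sub>R k))" for k
      by (simp add: inner_diff_left inner_commute[of k y] right_diff_distrib exp_diff exp_minus field_simps)
    then have "fourier ?g y = of_real (2 * pi / e\<^sup>2 * gauss ((x - y) /\<^sub>R e))"
      unfolding fourier_def using gauss_fourier_scaled(2)[OF e] by presburger
    moreover have "(x - y) /\<^sub>R e = - ((y - x) /\<^sub>R e)" by (simp add: scaleR_diff_right)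
    ultimately show ?thesis by (simp only: gauss_simps)
  qed
  have "(\<integral>k. fourier w k * ?g k \<partial>lborel) = (\<integral>y. w y * of_real (2 * pi / e\<^sup>2 * gauss ((y - x) /\<^sub>R e)) \<partial>lborel)"
    unfolding fourier_multiplication[OF w gauss_fourier_scaled(1)[OF e]] g ..
  also have "\<dots> = e\<^sup>2 *\<^sub>R (\<integral>z. w (x + e *\<^sub>R z) * of_real (2 * pi / e\<^sup>2 * gauss ((x + e *\<^sub>R z - x) /\<^sub>R e)) \<partial>lborel)"
    using e by (intro integral_scale_plane) auto
  also have "(\<lambda>z. w (x + e *\<^sub>R z) * of_real (2 * pi / e\<^sup>2 * gauss ((x + e *\<^sub>R z - x) /\<^sub>R e)))
     = (\<lambda>z. of_real (2 * pi / e\<^sup>2) * (w (x + e *\<^sub>R z) * of_real (gauss z)))"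
    using e by (simp add: fun_eq_iff)
  finally show ?thesis
    using e by (simp add: scaleR_conv_of_real)
qed

theorem fourier_inversion:
  assumes "schwartz w"
  shows "(\<integral>k. exp (\<i> * of_real (x \<bullet> k)) * fourier w k \<partial>lborel) = of_real ((2 * pi)\<^sup>2) * w x"
proof -
  obtain D where "D 0 0 = w" and D: "schwartz_family D"
    using assms unfolding schwartz_iff_family by (elim exE conjE that)
  then have w: "w = D 0 0" by simp
  have int: "integrable lborel w" unfolding w by (rule schwartz_family_integrable[OF D])
  have cont: "continuous_on UNIV w" unfolding w by (rule schwartz_family_continuous[OF D])
  have [measurable]: "w \<in> borel_measurable borel" unfolding w by (rule schwartz_family_measurable[OF D])
  obtain C where C: "\<And>y. norm (w y) \<le> C" unfolding w using schwartz_family_bounded[OF D] by blast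
  have fint: "integrable lborel (\<lambda>k. norm (fourier w k))"
  proof (rule Bochner_Integration.integrable_bound[OF schwartz_fourier_integrable[OF assms]])
    show "AE k in lborel. norm (norm (fourier w k)) \<le> norm ((1 + norm k) * norm (fourier w k))"
      by (intro AE_I2) (auto simp: distrib_right abs_mult intro!: add_increasing2)
  qed measurable
  define e where "e = (\<lambda>n. inverse (real (Suc n)))"
  have e: "e n > 0" for n by (simp add: e_def)
  have e0: "e \<longlonglongrightarrow> 0" unfolding e_def by (rule LIMSEQ_inverse_real_of_nat)
  have "(\<lambda>n. \<integral>k. fourier w k * (exp (\<i> * of_real (x \<bullet> k)) * of_real (gauss (e n *\<^sub>R k))) \<partial>lborel)
     \<longlonglongrightarrow> (\<integral>k. exp (\<i> * of_real (x \<bullet> k)) * fourier w k \<partial>lborel)"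
  proof (rule integral_dominated_convergence[OF _ _ fint])
    show "AE k in lborel. (\<lambda>n. fourier w k * (exp (\<i> * of_real (x \<bullet> k)) * of_real (gauss (e n *\<^sub>R k))))
        \<longlonglongrightarrow> exp (\<i> * of_real (x \<bullet> k)) * fourier w k"
    proof (rule AE_I2)
      fix k
      have "(\<lambda>n. gauss (e n *\<^sub>R k)) \<longlonglongrightarrow> exp (- (norm (0 *\<^sub>R k))\<^sup>2 / 2)"
        unfolding gauss_def by (intro tendsto_intros e0) auto
      then have "(\<lambda>n. fourier w k * (exp (\<i> * of_real (x \<bullet> k)) * of_real (gauss (e n *\<^sub>R k))))
         \<longlonglongrightarrow> fourier w k * (exp (\<i> * of_real (x \<bullet> k)) * of_real (exp (- (norm (0 *\<^sub>R k))\<^sup>2 / 2)))"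
        by (intro tendsto_intros)
      then show "(\<lambda>n. fourier w k * (exp (\<i> * of_real (x \<bullet> k)) * of_real (gauss (e n *\<^sub>R k))))
        \<longlonglongrightarrow> exp (\<i> * of_real (x \<bullet> k)) * fourier w k" by (simp add: mult.commute)
    qed
    show "AE k in lborel. norm (fourier w k * (exp (\<i> * of_real (x \<bullet> k)) * of_real (gauss (e n *\<^sub>R k)))) \<le> norm (fourier w k)" for n
      using gauss_simps(1,2) by (intro AE_I2) (auto simp: norm_mult intro!: mult_left_le)
  qed measurable
  moreover have "(\<lambda>n. \<integral>k. fourier w k * (exp (\<i> * of_real (x \<bullet> k)) * of_real (gauss (e n *\<^sub>R k))) \<partial>lborel)
      \<longlonglongrightarrow> of_real (2 * pi) * (w x * of_real (2 * pi))"
    unfolding gaussian_regularized_inversion[OF int e]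
  proof (intro tendsto_mult tendsto_const)
    have "(\<lambda>n. \<integral>z. w (x + e n *\<^sub>R z) * of_real (gauss z) \<partial>lborel) \<longlonglongrightarrow> (\<integral>z. w x * of_real (gauss z) \<partial>lborel)"
    proof (rule integral_dominated_convergence[where w="\<lambda>z. C * gauss z"])
      show "integrable lborel (\<lambda>z. C * gauss z)" using gauss_integral(1) by simp
      show "AE z in lborel. (\<lambda>n. w (x + e n *\<^sub>R z) * of_real (gauss z)) \<longlonglongrightarrow> w x * of_real (gauss z)"
      proof (intro AE_I2 tendsto_mult tendsto_const)
        fix z
        have "(\<lambda>n. x + e n *\<^sub>R z) \<longlonglongrightarrow> x + 0 *\<^sub>R z" by (intro tendsto_intros e0)
        then show "(\<lambda>n. w (x + e n *\<^sub>R z)) \<longlonglongrightarrow> w x"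
          using continuous_on_tendsto_compose[OF cont] by fastforce
      qed
      show "AE z in lborel. norm (w (x + e n *\<^sub>R z) * of_real (gauss z)) \<le> C * gauss z" for n
        by (intro AE_I2) (simp add: norm_mult gauss_simps(1) mult_right_mono[OF C])
    qed measurable
    then show "(\<lambda>n. \<integral>z. w (x + e n *\<^sub>R z) * of_real (gauss z) \<partial>lborel) \<longlonglongrightarrow> w x * of_real (2 * pi)"
      by (simp only: integral_mult_right_zero gauss_integral(2))
  qed
  ultimately have "(\<integral>k. exp (\<i> * of_real (x \<bullet> k)) * fourier w k \<partial>lborel) = of_real (2 * pi) * (w x * of_real (2 * pi))"
    by (rule LIMSEQ_unique)
  then show ?thesis by (simp add: power2_eq_square)
qed

section \<open>Operators with a homogeneous kernel\<close>

text \<open>Fourier inversion writes the second difference \<open>w (x - y) + w (x + y) - 2 w x\<close> as a superposition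
of plane waves multiplied by \<open>2 (cos (k \<bullet> y) - 1)\<close>. Integrating against \<open>K(y)\<close> first gives a
multiple of \<open>m(k)\<close> by \<open>homogeneous_kernel_integral\<close>. The exchange of the integrals is
legitimate because \<open>(1 + norm k) \<bar>fourier w k\<bar>\<close> is integrable.\<close>

theorem has_kernel_of_symbol:
  assumes K: "homogeneous_kernel K"
    and int: "integrable lborel (\<lambda>t. (1 + \<bar>t\<bar>) * K (1, t))"
    and m: "\<And>k. m k = 1 / 2 * (\<integral>t. \<bar>fst k + snd k * t\<bar> * K (1, t) \<partial>lborel)"
  shows "has_kernel (symbol_operator m) K"
  unfolding has_kernel_def
proof (intro allI impI)
  fix w :: "real \<times> real \<Rightarrow> complex" and x :: "real \<times> real"
  assume w: "schwartz w"
  have [measurable]: "K \<in> borel_measurable borel" using K by (simp add: homogeneous_kernel_def)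
  have [measurable]: "w \<in> borel_measurable borel"
    using w schwartz_family_measurable unfolding schwartz_iff_family by blast
  have wint: "integrable lborel (\<lambda>k. exp (\<i> * of_real (z \<bullet> k)) * fourier w k)" for z
  proof (rule Bochner_Integration.integrable_bound[OF schwartz_fourier_integrable[OF w]])
    show "AE k in lborel. norm (exp (\<i> * of_real (z \<bullet> k)) * fourier w k) \<le> norm ((1 + norm k) * norm (fourier w k))"
      by (intro AE_I2) (auto simp: norm_mult distrib_right abs_mult intro!: add_increasing2)
  qed measurable
  define C where "C = pi * (\<integral>t. (1 + \<bar>t\<bar>) * \<bar>K (1, t)\<bar> \<partial>lborel)"
  have C: "C \<ge> 0" unfolding C_def by (intro mult_nonneg_nonneg integral_nonneg_AE) auto
  let ?H = "\<lambda>(k, y). exp (\<i> * of_real (x \<bullet> k)) * fourier w k * of_real (2 * ((1 - cos (k \<bullet> y)) * K y))"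
  have inner: "(\<integral>y. norm (?H (k, y)) \<partial>lborel) \<le> 2 * C * ((1 + norm k) * norm (fourier w k))" for k
  proof -
    have "(\<integral>y. (1 - cos (k \<bullet> y)) * \<bar>K y\<bar> \<partial>lborel) = enn2real (\<integral>\<^sup>+y. ennreal ((1 - cos (k \<bullet> y)) * \<bar>K y\<bar>) \<partial>lborel)"
      by (intro integral_eq_nn_integral) auto
    also have "\<dots> \<le> norm k * C"
      using homogeneous_kernel_nn_bound[OF K int, of k] C unfolding C_def[symmetric]
      by (intro enn2real_leI) auto
    also have "\<dots> \<le> (1 + norm k) * C" using C by (intro mult_right_mono) auto
    finally have "norm (fourier w k) * (2 * (\<integral>y. (1 - cos (k \<bullet> y)) * \<bar>K y\<bar> \<partial>lborel)) \<le> norm (fourier w k) * (2 * ((1 + norm k) * C))"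
      by (intro mult_left_mono) auto
    moreover have "norm (?H (k, y)) = norm (fourier w k) * (2 * ((1 - cos (k \<bullet> y)) * \<bar>K y\<bar>))" for y
      by (simp add: norm_mult abs_mult del: of_real_mult of_real_diff)
    then have "(\<integral>y. norm (?H (k, y)) \<partial>lborel)
      = norm (fourier w k) * (2 * (\<integral>y. (1 - cos (k \<bullet> y)) * \<bar>K y\<bar> \<partial>lborel))"
      by (simp only: integral_mult_right_zero)
    ultimately show ?thesis by (simp only: ac_simps)
  qed
  have H: "integrable (lborel \<Otimes>\<^sub>M lborel) ?H"
  proof (rule lborel_pair.Fubini_integrable)
    show "?H \<in> borel_measurable (lborel \<Otimes>\<^sub>M lborel)" by measurable
    show "integrable lborel (\<lambda>k. \<integral>y. norm (?H (k, y)) \<partial>lborel)"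
    proof (rule Bochner_Integration.integrable_bound)
      show "integrable lborel (\<lambda>k. 2 * C * ((1 + norm k) * norm (fourier w k)))"
        using schwartz_fourier_integrable[OF w] by simp
      show "(\<lambda>k. \<integral>y. norm (?H (k, y)) \<partial>lborel) \<in> borel_measurable lborel"
        by measurable
      show "AE k in lborel. norm (\<integral>y. norm (?H (k, y)) \<partial>lborel) \<le> norm (2 * C * ((1 + norm k) * norm (fourier w k)))"
      proof (rule AE_I2)
        fix k
        have "(\<integral>y. norm (?H (k, y)) \<partial>lborel) \<ge> 0" by (intro integral_nonneg_AE) auto
        with inner[of k] show "norm (\<integral>y. norm (?H (k, y)) \<partial>lborel) \<le> norm (2 * C * ((1 + norm k) * norm (fourier w k)))"
          unfolding real_norm_def by linarith
      qed
    qed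
    show "AE k in lborel. integrable lborel (\<lambda>y. ?H (k, y))"
      using homogeneous_kernel_integrable[OF K int]
      by (intro AE_I2) (simp del: of_real_mult of_real_diff)
  qed
  have in_y: "(\<integral>y. ?H (k, y) \<partial>lborel) = of_real (4 * pi) * (exp (\<i> * of_real (x \<bullet> k)) * (of_real (m k) * fourier w k))" for k
  proof -
    have "(\<integral>y. ?H (k, y) \<partial>lborel) = exp (\<i> * of_real (x \<bullet> k)) * fourier w k * of_real (2 * (\<integral>y. (1 - cos (k \<bullet> y)) * K y \<partial>lborel))"
      by (simp del: of_real_mult of_real_diff)
    also have "(\<integral>y. (1 - cos (k \<bullet> y)) * K y \<partial>lborel) = 2 * pi * m k"
      using homogeneous_kernel_integral[OF K int, of k] m[of k] by simp
    finally show ?thesis by (simp add: ac_simps)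
  qed
  define c where "c = complex_of_real ((2 * pi)\<^sup>2)"
  have c0: "c \<noteq> 0" by (simp add: c_def)
  have in_k: "(\<integral>k. ?H (k, y) \<partial>lborel) = - c * ((w (x - y) + w (x + y) - 2 * w x) * of_real (K y))" for y
  proof -
    define W where "W = (\<lambda>z k. exp (\<i> * of_real (z \<bullet> k)) * fourier w k)"
    have W: "integrable lborel (W z)" "(\<integral>k. W z k \<partial>lborel) = c * w z" for z
      using wint[of z] fourier_inversion[OF w, of z] by (simp_all only: W_def c_def)
    have eq: "?H (k, y) = (2 * W x k - W (x + y) k - W (x - y) k) * of_real (K y)" for k
    proof -
      let ?P = "exp (\<i> * of_real (y \<bullet> k))" and ?N = "exp (- (\<i> * of_real (y \<bullet> k)))"
      have "2 * complex_of_real (cos (k \<bullet> y)) = ?P + ?N"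
        by (simp add: inner_commute[of k] cos_exp_eq flip: cos_of_real)
      then have cos: "complex_of_real (2 * ((1 - cos (k \<bullet> y)) * K y)) = (2 - (?P + ?N)) * of_real (K y)"
        by (simp add: algebra_simps)
      have W': "W (x + y) k = exp (\<i> * of_real (x \<bullet> k)) * ?P * fourier w k"
        "W (x - y) k = exp (\<i> * of_real (x \<bullet> k)) * ?N * fourier w k"
        by (simp_all add: W_def inner_add_left inner_diff_left distrib_left right_diff_distrib flip: exp_add)
      have W'': "W x k = exp (\<i> * of_real (x \<bullet> k)) * fourier w k" by (simp add: W_def)
      show ?thesis unfolding prod.case cos W' W'' by algebra
    qed
    have "(\<integral>k. ?H (k, y) \<partial>lborel) = (\<integral>k. 2 * W x k - W (x + y) k - W (x - y) k \<partial>lborel) * of_real (K y)"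
      unfolding eq by (rule integral_mult_left_zero)
    also have "(\<integral>k. 2 * W x k - W (x + y) k - W (x - y) k \<partial>lborel) = 2 * (c * w x) - c * w (x + y) - c * w (x - y)"
      by (simp add: W)
    finally show ?thesis by (simp add: algebra_simps)
  qed
  have int_y: "integrable lborel (\<lambda>y. - c * ((w (x - y) + w (x + y) - 2 * w x) * of_real (K y)))"
    using lborel_pair.integrable_snd[of "\<lambda>k y. ?H (k, y)"] H in_k by simp
  then show "integrable lborel (\<lambda>y. (w (x - y) + w (x + y) - 2 * w x) * of_real (K y)) \<and>
       symbol_operator m w x = - of_real (1 / (4 * pi)) *
         (\<integral>y. (w (x - y) + w (x + y) - 2 * w x) * of_real (K y) \<partial>lborel)"
  proof (intro conjI)
    show "integrable lborel (\<lambda>y. (w (x - y) + w (x + y) - 2 * w x) * of_real (K y))"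
    proof -
      have "- inverse c * (- c * z) = z" for z using c0 by simp
      then show ?thesis using integrable_mult_right[OF int_y, of "- inverse c"] by (simp only:)
    qed
    have "(\<integral>y. (\<integral>k. ?H (k, y) \<partial>lborel) \<partial>lborel) = (\<integral>k. (\<integral>y. ?H (k, y) \<partial>lborel) \<partial>lborel)"
      using lborel_pair.Fubini_integral[of "\<lambda>k y. ?H (k, y)"] H by simp
    then have "- c * (\<integral>y. (w (x - y) + w (x + y) - 2 * w x) * of_real (K y) \<partial>lborel)
      = of_real (4 * pi) * (\<integral>k. exp (\<i> * of_real (x \<bullet> k)) * (of_real (m k) * fourier w k) \<partial>lborel)"
      unfolding in_k in_y by (simp only: integral_mult_right_zero)
    moreover have "symbol_operator m w x = inverse c * (\<integral>k. exp (\<i> * of_real (x \<bullet> k)) * (of_real (m k) * fourier w k) \<partial>lborel)"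
      by (simp add: symbol_operator_def inverse_fourier_def c_def field_simps)
    moreover have "s = - of_real (1 / (4 * pi)) * a"
      if "- c * a = of_real (4 * pi) * b" "s = inverse c * b" for s a b
    proof -
      have "b = - c * a / of_real (4 * pi)" using that(1) by (simp add: field_simps)
      with that(2) c0 show ?thesis by (simp add: field_simps)
    qed
    ultimately show "symbol_operator m w x = - of_real (1 / (4 * pi)) *
         (\<integral>y. (w (x - y) + w (x + y) - 2 * w x) * of_real (K y) \<partial>lborel)"
      by blast
  qed
qed

section \<open>Polynomials times Gaussians as test functions\<close>

text \<open>The exponential series gives \<open>(n v)\<^bsup>m\<^esup> / m! \<le> exp (n v)\<close> for \<open>v = 1 + \<bar>s\<bar>\<close>, and the quadratic
exponent absorbs \<open>n v\<close> up to a constant.\<close>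

lemma power_exp_bound:
  fixes n :: real
  assumes n: "n > 0"
  shows "\<exists>B. \<forall>s. (1 + \<bar>s\<bar>) ^ m * exp (- n * (s - a)\<^sup>2) \<le> B"
proof -
  have le: "(1 + \<bar>s\<bar>) ^ m * exp (- n * (s - a)\<^sup>2)
     \<le> (fact m / n ^ m) * exp (n * (2 + \<bar>a\<bar>))" for s
  proof -
    have "(n * (1 + \<bar>s\<bar>)) ^ m / fact m \<le> exp (n * (1 + \<bar>s\<bar>))"
    proof -
      have "(n * (1 + \<bar>s\<bar>)) ^ m / fact m = (\<Sum>k\<in>{m}. (n * (1 + \<bar>s\<bar>)) ^ k /\<^sub>R fact k)"
        by (simp add: divide_inverse_commute)
      also have "\<dots> \<le> exp (n * (1 + \<bar>s\<bar>))"
        unfolding exp_def using n summable_exp_generic[of "n * (1 + \<bar>s\<bar>)"]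
        by (intro sum_le_suminf) auto
      finally show ?thesis .
    qed
    then have "(1 + \<bar>s\<bar>) ^ m \<le> (fact m / n ^ m) * exp (n * (1 + \<bar>s\<bar>))"
      using n by (simp add: power_mult_distrib pos_le_divide_eq divide_le_eq mult.commute)
    then have "(1 + \<bar>s\<bar>) ^ m * exp (- n * (s - a)\<^sup>2)
      \<le> (fact m / n ^ m) * exp (n * (1 + \<bar>s\<bar>)) * exp (- n * (s - a)\<^sup>2)"
      by (rule mult_right_mono) simp
    also have "\<dots> = (fact m / n ^ m) * exp (n * (1 + \<bar>s\<bar> - (s - a)\<^sup>2))"
      by (simp add: right_diff_distrib mult.assoc flip: exp_add)
    also have "\<dots> \<le> (fact m / n ^ m) * exp (n * (2 + \<bar>a\<bar>))"
    proof -
      have "\<bar>s\<bar> \<le> \<bar>a\<bar> + \<bar>s - a\<bar>" by linarith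
      moreover have "\<bar>u\<bar> \<le> 1 + u\<^sup>2" for u :: real
      proof -
        have "2 * \<bar>u\<bar> \<le> 1 + u\<^sup>2" using zero_le_power2[of "\<bar>u\<bar> - 1"] by (simp add: power2_diff)
        then show ?thesis by simp
      qed
      from this[of "s - a"] have "\<bar>s - a\<bar> \<le> 1 + (s - a)\<^sup>2" .
      ultimately have "1 + \<bar>s\<bar> - (s - a)\<^sup>2 \<le> 2 + \<bar>a\<bar>" by linarith
      then show ?thesis using n by (intro mult_left_mono) auto
    qed
    finally show ?thesis .
  qed
  then show ?thesis by blast
qed

lemma poly_gauss_bounded:
  fixes n a :: real
  assumes n: "n > 0"
  shows "\<exists>B. \<forall>s. (1 + \<bar>s\<bar>) ^ m * \<bar>poly P s * exp (- n * (s - a)\<^sup>2)\<bar> \<le> B"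
proof (induction P arbitrary: m)
  case 0
  show ?case by auto
next
  case (pCons c P)
  obtain B where B: "\<And>s. (1 + \<bar>s\<bar>) ^ Suc m * \<bar>poly P s * exp (- n * (s - a)\<^sup>2)\<bar> \<le> B"
    using pCons.IH by blast
  obtain B' where B': "\<And>s. (1 + \<bar>s\<bar>) ^ m * exp (- n * (s - a)\<^sup>2) \<le> B'"
    using power_exp_bound[OF n] by blast
  have "(1 + \<bar>s\<bar>) ^ m * \<bar>poly (pCons c P) s * exp (- n * (s - a)\<^sup>2)\<bar> \<le> \<bar>c\<bar> * B' + B" for s
  proof -
    let ?e = "exp (- n * (s - a)\<^sup>2)"
    have "\<bar>poly (pCons c P) s\<bar> \<le> \<bar>c\<bar> + (1 + \<bar>s\<bar>) * \<bar>poly P s\<bar>"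
    proof -
      have "\<bar>poly (pCons c P) s\<bar> \<le> \<bar>c\<bar> + \<bar>s\<bar> * \<bar>poly P s\<bar>"
        using abs_triangle_ineq[of c "s * poly P s"] by (simp add: abs_mult)
      also have "\<dots> \<le> \<bar>c\<bar> + (1 + \<bar>s\<bar>) * \<bar>poly P s\<bar>" by (simp add: distrib_right)
      finally show ?thesis .
    qed
    then have "(1 + \<bar>s\<bar>) ^ m * (\<bar>poly (pCons c P) s\<bar> * ?e) \<le> (1 + \<bar>s\<bar>) ^ m * ((\<bar>c\<bar> + (1 + \<bar>s\<bar>) * \<bar>poly P s\<bar>) * ?e)"
      by (intro mult_left_mono mult_right_mono) auto
    also have "\<dots> = \<bar>c\<bar> * ((1 + \<bar>s\<bar>) ^ m * ?e) + (1 + \<bar>s\<bar>) ^ Suc m * \<bar>poly P s * ?e\<bar>"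
      by (simp add: abs_mult algebra_simps)
    also have "\<dots> \<le> \<bar>c\<bar> * B' + B" by (intro add_mono mult_left_mono B B') auto
    finally show ?thesis by (simp add: abs_mult)
  qed
  then show ?case by blast
qed

text \<open>The polynomial factor of the \<open>i\<close>-th derivative of \<open>P(s) exp (- n (s - a)\<^sup>2)\<close>. For \<open>P = 1\<close> and
\<open>a = 0\<close> these are the Hermite polynomials, up to sign and scaling.\<close>

primrec hermite_factor :: "real \<Rightarrow> real \<Rightarrow> real poly \<Rightarrow> nat \<Rightarrow> real poly" where
  "hermite_factor n a P 0 = P"
| "hermite_factor n a P (Suc i) = pderiv (hermite_factor n a P i) + [:2 * n * a, - 2 * n:] * hermite_factor n a P i"

definition poly_gauss :: "real \<Rightarrow> real \<Rightarrow> real poly \<Rightarrow> real \<Rightarrow> real" where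
  "poly_gauss n a P s = poly P s * exp (- n * (s - a)\<^sup>2)"

lemma poly_gauss_derivative:
  "(poly_gauss n a (hermite_factor n a P i) has_real_derivative poly_gauss n a (hermite_factor n a P (Suc i)) s) (at s)"
  unfolding poly_gauss_def[abs_def]
  by (auto intro!: derivative_eq_intros poly_DERIV simp: algebra_simps)

lemma schwartz_poly_gauss:
  assumes n: "n > 0"
  shows "schwartz (\<lambda>x. complex_of_real (poly_gauss n a P (fst x) * poly_gauss n b Q (snd x)))"
proof -
  let ?f = "\<lambda>i. poly_gauss n a (hermite_factor n a P i)" and ?g = "\<lambda>j. poly_gauss n b (hermite_factor n b Q j)"
  let ?D = "\<lambda>i j x. complex_of_real (?f i (fst x) * ?g j (snd x))"
  have der: "(?D i j has_derivative (\<lambda>h. fst h *\<^sub>R ?D (Suc i) j x + snd h *\<^sub>R ?D i (Suc j) x)) (at x)" for i j x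
  proof -
    have "((\<lambda>x. ?f i (fst x)) has_derivative (\<lambda>h. ?f (Suc i) (fst x) * fst h)) (at x)"
      using has_derivative_compose[OF has_derivative_fst[OF has_derivative_ident]
          poly_gauss_derivative[of n a P i "fst x", unfolded has_field_derivative_def]] .
    moreover have "((\<lambda>x. ?g j (snd x)) has_derivative (\<lambda>h. ?g (Suc j) (snd x) * snd h)) (at x)"
      using has_derivative_compose[OF has_derivative_snd[OF has_derivative_ident]
          poly_gauss_derivative[of n b Q j "snd x", unfolded has_field_derivative_def]] .
    ultimately have "((\<lambda>x. ?f i (fst x) * ?g j (snd x)) has_derivative
        (\<lambda>h. ?f i (fst x) * (?g (Suc j) (snd x) * snd h) + ?f (Suc i) (fst x) * fst h * ?g j (snd x))) (at x)"
      by (rule has_derivative_mult)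
    from has_derivative_of_real[OF this] show ?thesis
      by (rule has_derivative_eq_rhs) (simp add: fun_eq_iff scaleR_conv_of_real algebra_simps del: hermite_factor.simps)
  qed
  have bnd: "bounded (range (\<lambda>x. norm x ^ m *\<^sub>R ?D i j x))" for i j m
  proof -
    obtain A where A: "\<And>s. (1 + \<bar>s\<bar>) ^ m * \<bar>?f i s\<bar> \<le> A"
      using poly_gauss_bounded[OF n] unfolding poly_gauss_def by blast
    obtain B where B: "\<And>s. (1 + \<bar>s\<bar>) ^ m * \<bar>?g j s\<bar> \<le> B"
      using poly_gauss_bounded[OF n] unfolding poly_gauss_def by blast
    have "norm (norm x ^ m *\<^sub>R ?D i j x) \<le> A * B" for x :: "real \<times> real"
    proof -
      have "norm x \<le> \<bar>fst x\<bar> + \<bar>snd x\<bar>"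
        using sqrt_sum_squares_le_sum_abs[of "fst x" "snd x"] by (simp add: norm_prod_def)
      moreover have "(1 + \<bar>fst x\<bar>) * (1 + \<bar>snd x\<bar>) = 1 + \<bar>fst x\<bar> + \<bar>snd x\<bar> + \<bar>fst x\<bar> * \<bar>snd x\<bar>"
        by algebra
      ultimately have "norm x \<le> (1 + \<bar>fst x\<bar>) * (1 + \<bar>snd x\<bar>)"
        using mult_nonneg_nonneg[OF abs_ge_zero[of "fst x"] abs_ge_zero[of "snd x"]] by linarith
      then have "norm x ^ m \<le> ((1 + \<bar>fst x\<bar>) * (1 + \<bar>snd x\<bar>)) ^ m" by (rule power_mono) simp
      then have "norm x ^ m * \<bar>?f i (fst x) * ?g j (snd x)\<bar>
          \<le> ((1 + \<bar>fst x\<bar>) * (1 + \<bar>snd x\<bar>)) ^ m * \<bar>?f i (fst x) * ?g j (snd x)\<bar>"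
        by (rule mult_right_mono) simp
      also have "\<dots> = ((1 + \<bar>fst x\<bar>) ^ m * \<bar>?f i (fst x)\<bar>) * ((1 + \<bar>snd x\<bar>) ^ m * \<bar>?g j (snd x)\<bar>)"
        by (simp add: power_mult_distrib abs_mult)
      also have "\<dots> \<le> A * B"
        by (intro mult_mono A B mult_nonneg_nonneg order_trans[OF _ A[of 0]]) auto
      finally show ?thesis by (simp add: norm_mult abs_mult)
    qed
    then show ?thesis unfolding bounded_iff by blast
  qed
  show ?thesis
    unfolding schwartz_def
    by (rule exI[of _ ?D]) (use der bnd in \<open>auto simp del: of_real_mult hermite_factor.simps(2)\<close>)
qed

section \<open>Uniqueness of the kernel\<close>

text \<open>If the even function \<open>d = K - K'\<close> were positive at \<open>z\<close>, it would be positive near \<open>z\<close> and near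
\<open>- z\<close>. Testing at the origin with \<open>w\<close>, where \<open>w 0 = 0\<close>, shows \<open>\<integral> V d = 0\<close> for the even function
\<open>V(y) = w(y) + w(- y)\<close>. For a Gaussian \<open>w\<close> of growing concentration at \<open>z\<close> the contribution of a
neighbourhood of \<open>\<plusminus> z\<close> dominates the rest, a contradiction. The polynomial factor is needed for
\<open>w 0 = 0\<close> and is a square, so that it is nonnegative.\<close>

lemma has_kernel_unique_le:
  assumes K: "has_kernel L K" "\<And>x. K (- x) = K x" "isCont K z"
    and K': "has_kernel L K'" "\<And>x. K' (- x) = K' x" "isCont K' z"
    and z: "z \<noteq> 0"
  shows "K z \<le> K' z"
proof (rule ccontr)
  assume "\<not> K z \<le> K' z"
  define d where "d = (\<lambda>y. K y - K' y)"
  have dz: "d z > 0" using \<open>\<not> K z \<le> K' z\<close> by (simp add: d_def)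
  have deven: "d (- y) = d y" for y using K(2) K'(2) by (simp add: d_def)
  \<comment> \<open>A square of a coordinate that does not vanish at \<open>z\<close>.\<close>
  obtain P Q :: "real poly" where q0: "poly P 0 * poly Q 0 = 0" and qz: "poly P (fst z) * poly Q (snd z) > 0"
    and qnn: "\<And>s t. poly P s * poly Q t \<ge> 0"
  proof (cases "fst z = 0")
    case False
    then show ?thesis by (intro that[of "[:0, 0, 1:]" 1]) (auto simp: zero_less_mult_iff)
  next
    case True
    then have "snd z \<noteq> 0" using z by (simp add: prod_eq_iff)
    then show ?thesis by (intro that[of 1 "[:0, 0, 1:]"]) (auto simp: zero_less_mult_iff)
  qed
  define q where "q = (\<lambda>y. poly P (fst y) * poly Q (snd y))"
  define w where "w = (\<lambda>n y. poly_gauss n (fst z) P (fst y) * poly_gauss n (snd z) Q (snd y))"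
  have w_eq: "w n y = q y * exp (- n * (norm (y - z))\<^sup>2)" for n y
    by (simp add: w_def q_def poly_gauss_def norm_prod_def algebra_simps flip: exp_add)
  have q: "q y \<ge> 0" for y using qnn by (simp add: q_def)
  have w0: "w n 0 = 0" for n using q0 by (simp add: w_eq q_def)
  have w_nn: "w n y \<ge> 0" for n y using q by (simp add: w_eq)
  define V where "V = (\<lambda>n y. w n y + w n (- y))"
  have V_nn: "V n y \<ge> 0" for n y using w_nn by (simp add: V_def)
  have Vint: "integrable lborel (\<lambda>y. V n y * d y)" "(\<integral>y. V n y * d y \<partial>lborel) = 0" if "n > 0" for n
  proof -
    let ?w = "\<lambda>y. complex_of_real (w n y)"
    have s: "schwartz ?w" unfolding w_def using schwartz_poly_gauss[OF that] .
    have eq: "(?w (0 - y) + ?w (0 + y) - 2 * ?w 0) * of_real k = complex_of_real (V n y * k)" for y k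
      by (simp add: V_def w0 algebra_simps)
    have 1: "integrable lborel (\<lambda>y. complex_of_real (V n y * K y))"
      "L ?w 0 = - of_real (1 / (4 * pi)) * (\<integral>y. complex_of_real (V n y * K y) \<partial>lborel)"
      using K(1)[unfolded has_kernel_def, rule_format, OF s, of 0] unfolding eq by auto
    have 2: "integrable lborel (\<lambda>y. complex_of_real (V n y * K' y))"
      "L ?w 0 = - of_real (1 / (4 * pi)) * (\<integral>y. complex_of_real (V n y * K' y) \<partial>lborel)"
      using K'(1)[unfolded has_kernel_def, rule_format, OF s, of 0] unfolding eq by auto
    have i: "integrable lborel (\<lambda>y. V n y * K y)" "integrable lborel (\<lambda>y. V n y * K' y)"
      using 1(1) 2(1) by (simp_all only: complex_of_real_integrable_eq)
    have "(\<integral>y. complex_of_real (V n y * K y) \<partial>lborel) = (\<integral>y. complex_of_real (V n y * K' y) \<partial>lborel)"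
      using 1(2) 2(2) by simp
    then have "(\<integral>y. V n y * K y \<partial>lborel) = (\<integral>y. V n y * K' y \<partial>lborel)"
      by (simp only: integral_complex_of_real of_real_eq_iff)
    then show "integrable lborel (\<lambda>y. V n y * d y)" "(\<integral>y. V n y * d y \<partial>lborel) = 0"
      using i by (simp_all add: d_def right_diff_distrib)
  qed
  have "isCont d z" "isCont q z"
    unfolding d_def q_def by (intro continuous_intros K(3) K'(3) isCont_o2[OF _ poly_isCont])+
  then have "(d \<longlongrightarrow> d z) (nhds z)" "(q \<longlongrightarrow> q z) (nhds z)"
    by (simp_all only: isCont_def tendsto_at_iff_tendsto_nhds)
  moreover have "q z / 2 < q z" "d z / 2 < d z" using qz dz by (simp_all add: q_def)
  ultimately have "\<forall>\<^sub>F y in nhds z. d y > d z / 2 \<and> q y > q z / 2"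
    by (intro eventually_conj order_tendstoD(1)) auto
  then obtain r where r: "r > 0" "\<And>y. dist y z < r \<Longrightarrow> d y > d z / 2 \<and> q y > q z / 2"
    unfolding eventually_nhds_metric by blast
  define s where "s = r / 2"
  have s: "s > 0" "r = 2 * s" using r by (simp_all add: s_def)
  define M where "M = q z / 2 * (d z / 2)"
  have M: "M > 0" using qz dz by (simp add: M_def q_def)
  define I where "I = (\<integral>y. \<bar>V 1 y * d y\<bar> \<partial>lborel)"
  \<comment> \<open>On \<open>ball z s\<close> the Gaussian is at least \<open>exp (- n s\<^sup>2)\<close>; at distance \<open>r = 2 s\<close> it is at most \<open>exp (- 4 (n - 1) s\<^sup>2)\<close> times the Gaussian for \<open>n = 1\<close>. The ratio tends to zero.\<close>
  have main: "M * measure lborel (ball z s) \<le> exp (4 * s\<^sup>2) * exp (- 3 * s\<^sup>2 * n) * I" if n: "n \<ge> 1" for n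
  proof -
    define c where "c = exp (4 * s\<^sup>2) * exp (- 3 * s\<^sup>2 * n)"
    \<comment> \<open>The identity \<open>\<integral> V n d = 0\<close>, multiplied by \<open>exp (n s\<^sup>2)\<close>, is bounded below pointwise: the first case is near \<open>\<plusminus> z\<close>, where \<open>d\<close> is positive, the second far from both points.\<close>
    have pw: "M * indicator (ball z s) y - c * \<bar>V 1 y * d y\<bar> \<le> exp (n * s\<^sup>2) * (V n y * d y)" for y
    proof (cases "dist y z < r \<or> dist (- y) z < r")
      case True
      then have dy: "d y > d z / 2" using r(2)[of y] r(2)[of "- y"] deven by auto
      then have dy0: "d y > 0" using dz by linarith
      have "M * indicator (ball z s) y \<le> exp (n * s\<^sup>2) * (V n y * d y)"
      proof (cases "y \<in> ball z s")
        case True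
        then have ys: "norm (y - z) < s" by (simp add: dist_norm norm_minus_commute)
        then have qy: "q y > q z / 2" using r(2)[of y] s by (simp add: dist_norm)
        have "exp (- n * s\<^sup>2) \<le> exp (- n * (norm (y - z))\<^sup>2)"
          using ys n by (auto intro!: mult_left_mono power_mono)
        then have "q z / 2 * exp (- n * s\<^sup>2) \<le> q y * exp (- n * (norm (y - z))\<^sup>2)"
          using qy q by (intro mult_mono) auto
        also have "\<dots> \<le> V n y" using w_nn[of n "- y"] unfolding w_eq[symmetric] V_def by simp
        finally have "q z / 2 * exp (- n * s\<^sup>2) * (d z / 2) \<le> V n y * d y"
          using dy dz V_nn by (intro mult_mono) auto
        then have "exp (n * s\<^sup>2) * (q z / 2 * exp (- n * s\<^sup>2) * (d z / 2)) \<le> exp (n * s\<^sup>2) * (V n y * d y)"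
          by (rule mult_left_mono) simp
        moreover have "exp (n * s\<^sup>2) * (q z / 2 * exp (- n * s\<^sup>2) * (d z / 2)) = M"
          by (simp add: M_def exp_minus)
        ultimately have "M \<le> exp (n * s\<^sup>2) * (V n y * d y)" by (simp only:)
        then show ?thesis using True by simp
      qed (use V_nn dy0 in simp)
      moreover have "c * \<bar>V 1 y * d y\<bar> \<ge> 0" by (simp add: c_def)
      ultimately show ?thesis by linarith
    next
      case False
      have far: "exp (n * s\<^sup>2) * w n u \<le> c * w 1 u" if "\<not> dist u z < r" for u
      proof -
        have "r\<^sup>2 \<le> (norm (u - z))\<^sup>2" using that r(1) by (intro power_mono) (auto simp: dist_norm)
        then have "(n - 1) * (4 * s\<^sup>2) \<le> (n - 1) * (norm (u - z))\<^sup>2"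
          using n s by (intro mult_left_mono) (auto simp: power_mult_distrib)
        then have "n * s\<^sup>2 - n * (norm (u - z))\<^sup>2 \<le> 4 * s\<^sup>2 - 3 * s\<^sup>2 * n - (norm (u - z))\<^sup>2"
          by (simp add: algebra_simps)
        then have "exp (n * s\<^sup>2 - n * (norm (u - z))\<^sup>2) \<le> exp (4 * s\<^sup>2 - 3 * s\<^sup>2 * n - (norm (u - z))\<^sup>2)"
          by simp
        then have "q u * exp (n * s\<^sup>2 - n * (norm (u - z))\<^sup>2) \<le> q u * exp (4 * s\<^sup>2 - 3 * s\<^sup>2 * n - (norm (u - z))\<^sup>2)"
          using q by (rule mult_left_mono)
        then show ?thesis
          by (simp add: w_eq c_def exp_diff exp_add exp_minus field_simps)
      qed
      have "exp (n * s\<^sup>2) * V n y \<le> c * V 1 y"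
        using far[of y] far[of "- y"] False by (simp add: V_def distrib_left)
      then have "exp (n * s\<^sup>2) * V n y * \<bar>d y\<bar> \<le> c * V 1 y * \<bar>d y\<bar>"
        by (rule mult_right_mono) simp
      then have "\<bar>exp (n * s\<^sup>2) * (V n y * d y)\<bar> \<le> c * \<bar>V 1 y * d y\<bar>"
        using V_nn by (simp add: abs_mult mult.assoc)
      moreover have "y \<notin> ball z s" using False s by (auto simp: dist_commute)
      ultimately show ?thesis by simp
    qed
    have n0: "n > 0" using n by simp
    have fin: "emeasure lborel (ball z s) < \<infinity>" by (rule emeasure_bounded_finite) simp
    have "(\<integral>y. M * indicator (ball z s) y - c * \<bar>V 1 y * d y\<bar> \<partial>lborel) \<le> (\<integral>y. exp (n * s\<^sup>2) * (V n y * d y) \<partial>lborel)"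
      using Vint(1)[OF n0] Vint(1)[of 1] fin by (intro integral_mono pw) auto
    moreover have "(\<integral>y. M * indicator (ball z s) y - c * \<bar>V 1 y * d y\<bar> \<partial>lborel) = M * measure lborel (ball z s) - c * I"
      using Vint(1)[of 1] fin by (subst Bochner_Integration.integral_diff) (auto simp: I_def)
    moreover have "(\<integral>y. exp (n * s\<^sup>2) * (V n y * d y) \<partial>lborel) = 0" using Vint(2)[OF n0] by simp
    ultimately show ?thesis by (simp add: c_def)
  qed
  have "((\<lambda>n::real. exp (4 * s\<^sup>2) * exp (- 3 * s\<^sup>2 * n) * I) \<longlongrightarrow> exp (4 * s\<^sup>2) * 0 * I) at_top"
  proof (intro tendsto_intros)
    have "filterlim (\<lambda>n::real. - 3 * s\<^sup>2 * n) at_bot at_top"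
      using s by (intro filterlim_tendsto_neg_mult_at_bot[OF tendsto_const] filterlim_ident) auto
    then show "((\<lambda>n::real. exp (- 3 * s\<^sup>2 * n)) \<longlongrightarrow> 0) at_top"
      by (rule filterlim_compose[OF exp_at_bot])
  qed
  then have "M * measure lborel (ball z s) \<le> exp (4 * s\<^sup>2) * 0 * I"
  proof (rule tendsto_lowerbound)
    show "\<forall>\<^sub>F n in at_top. M * measure lborel (ball z s) \<le> exp (4 * s\<^sup>2) * exp (- 3 * s\<^sup>2 * n) * I"
      using eventually_ge_at_top[of 1] by eventually_elim (rule main)
  qed simp
  then have "M * measure lborel (ball z s) \<le> 0" by (simp only: mult_zero_right mult_zero_left)
  moreover have "measure lborel (ball z s) > 0"
    using s by (simp add: content_ball_pos)
  then have "M * measure lborel (ball z s) > 0" by (rule mult_pos_pos[OF M])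
  ultimately show False by linarith
qed

section \<open>The kernel of the operator\<close>

lemma L_kernel_even: "L_kernel \<mu> \<delta> \<nu> (- x) = L_kernel \<mu> \<delta> \<nu> x"
  by (simp add: L_kernel_def K1_def K2_def Let_def form12_def quartic_def)

lemma isCont_L_kernel:
  assumes "0 < \<delta>" "x \<noteq> 0" "quartic \<delta> \<nu> x \<noteq> 0"
  shows "isCont (L_kernel \<mu> \<delta> \<nu>) x"
proof -
  have pos: "(fst x)\<^sup>2 + \<delta> * (snd x)\<^sup>2 > 0" "(fst x)\<^sup>2 + (snd x)\<^sup>2 > 0"
    using assms(1,2) by (auto simp: prod_eq_iff intro: add_pos_nonneg add_nonneg_pos)
  have c: "isCont (form12 A B C D E F G) x" "isCont (quartic \<delta> \<nu>) x" for A B C D E F G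
    using continuous_on_form12[OF continuous_on_id[of UNIV]] continuous_on_quartic[OF continuous_on_id[of UNIV]]
    unfolding continuous_on_eq_continuous_at[OF open_UNIV] by blast+
  show ?thesis
    unfolding L_kernel_def[abs_def] K1_def[abs_def] K2_def[abs_def] Let_def
    using pos assms(3) by (intro continuous_intros c) auto
qed

theorem proposition3p4:
  fixes \<mu> \<delta> \<nu> :: real
  assumes "\<mu> > 0" and "0 < \<delta>" and "\<delta> < 4" and "1 - 2 / \<delta> < \<nu>" and "\<nu> < 1 / 2"
  shows "has_kernel (symbol_operator (symbol \<mu> \<delta> \<nu>)) (L_kernel \<mu> \<delta> \<nu>) \<and>
    (\<forall>K :: real \<times> real \<Rightarrow> real.
       continuous_on (- {0}) K \<longrightarrow> (\<forall>x. K (- x) = K x) \<longrightarrow>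
       has_kernel (symbol_operator (symbol \<mu> \<delta> \<nu>)) K \<longrightarrow>
       (\<forall>x. x \<noteq> 0 \<longrightarrow> quartic \<delta> \<nu> x \<noteq> 0 \<longrightarrow> K x = L_kernel \<mu> \<delta> \<nu> x))"
proof (intro conjI allI impI)
  have \<nu>: "\<nu> < 1" using assms by simp
  show kernel: "has_kernel (symbol_operator (symbol \<mu> \<delta> \<nu>)) (L_kernel \<mu> \<delta> \<nu>)"
    by (intro has_kernel_of_symbol homogeneous_kernel_L_kernel integrable_L_kernel_slopes
        symbol_eq_slope_integral assms(2) \<nu>)
  fix K :: "real \<times> real \<Rightarrow> real" and x
  assume K: "continuous_on (- {0}) K" "\<forall>x. K (- x) = K x" "has_kernel (symbol_operator (symbol \<mu> \<delta> \<nu>)) K"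
    and x: "x \<noteq> 0" "quartic \<delta> \<nu> x \<noteq> 0"
  have "isCont K x" using K(1) x(1) by (simp add: continuous_on_eq_continuous_at open_Compl)
  moreover have "isCont (L_kernel \<mu> \<delta> \<nu>) x" using isCont_L_kernel assms(2) x by blast
  ultimately show "K x = L_kernel \<mu> \<delta> \<nu> x"
    using has_kernel_unique_le[OF K(3) _ _ kernel L_kernel_even _ x(1)]
      has_kernel_unique_le[OF kernel L_kernel_even _ K(3) _ _ x(1)] K(2)
    by (intro antisym) auto
qed

end
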